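(* Let $K\ge2$, $r\ge1$ and $d\ge Kr$ be integers, let $\sigma\ge0$, and let $U_{s,1},\dots,U_{s,K}\in\mathbb{R}^{d\times r}$ have orthonormal columns with $U_{s,k}^\top U_{s,\ell}=0$ for all $k\ne\ell$. For $\epsilon>0$ and prompt length $n$, let $g^\star_{\mathcal W}$ be the optimal linear attention model (see context) for training prompts of length $n$ whose task vector is drawn from the mixture $$w\sim\sum_{k=1}^K\frac1K\,\mathcal N(0,\Sigma_{s,k}),\qquad\Sigma_{s,k}=U_{s,k}U_{s,k}^\top+\epsilon I_d .$$ Let $\alpha_1,\dots,\alpha_K\in\mathbb{R}$ with $\sum_{k=1}^K\alpha_k^2=1$, let $\overline U_t=\sum_{k=1}^K\alpha_kU_{s,k}$, and let test prompts $\widetilde Z$ of length $m$, with query label $\widetilde y_{m+1}$, be generated with test task vector $\widetilde w\sim\mathcal N(0,\overline\Sigma_t)$, $\overline\Sigma_t=\overline U_t\overline U_t^\top+\epsilon I_d$. Then, for any such $\{\alpha_k\}_{k=1}^K$, $$\lim_{m\to\infty}\lim_{n\to\infty}\lim_{\epsilon\to0}\mathbb E\Big[\big(\widetilde y_{m+1}-g^\star_{\mathcal W}(\widetilde Z)\big)^2\Big]=\sigma^2 .$$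
   Context: Training data: $x_1,\dots,x_{n+1}\sim\mathcal N(0,I_d)$ independent, task vector $w\in\mathbb{R}^d$ (shared by the whole prompt) independent of the $x_i$, noise $\xi_i\sim\mathcal N(0,\sigma^2)$ independent of everything else, and $y_i=w^\top x_i+\xi_i$ for $i\in\{1,\dots,n+1\}$. Prompt: $Z\in\mathbb{R}^{(n+1)\times(d+1)}$ with rows $z_i^\top=(x_i^\top,y_i)$ for $i\le n$ and $z_{n+1}^\top=(x_{n+1}^\top,0)$; masked prompt $Z_{\mathcal M}$ is $Z$ with its last row replaced by zero. Linear attention with weights $\mathcal W=\{W_Q,W_K,W_V\}$, each in $\mathbb{R}^{(d+1)\times(d+1)}$, and $p=(0_d^\top,1)^\top$: $$g_{\mathcal W}(Z)=\frac1n\big(z_{n+1}^\top W_QW_K^\top Z_{\mathcal M}^\top\big)Z_{\mathcal M}W_Vp .$$ The optimal model $g^\star_{\mathcal W}$ uses weights $\mathcal W^\star$ minimizing the training loss $\mathcal L(\mathcal W)=\mathbb E[(y_{n+1}-g_{\mathcal W}(Z))^2]$ (so it depends on $n$ and $\epsilon$). Test data: $x_1,\dots,x_{m+1}\sim\mathcal N(0,I_d)$ independent, $\widetilde w$ independent of them, $\widetilde y_j=\widetilde w^\top x_j+\xi_j$ with $\xi_j\sim\mathcal N(0,\sigma^2)$ independent, $j\in\{1,\dots,m+1\}$, all independent of the training data. The test prompt $\widetilde Z\in\mathbb{R}^{(m+1)\times(d+1)}$ has rows $(x_j^\top,\widetilde y_j)$ for $j\le m$ and last row $\widetilde z_{m+1}^\top=(x_{m+1}^\top,0)$;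 with $\widetilde Z_{\mathcal M}$ its masked version, the test prediction is $$g^\star_{\mathcal W}(\widetilde Z)=\frac1m\big(\widetilde z_{m+1}^\top W_Q^\star W_K^{\star\top}\widetilde Z_{\mathcal M}^\top\big)\widetilde Z_{\mathcal M}W_V^\star p ,$$ normalized by $m$ instead of $n$. The expectation in the test risk is over all test randomness. *)

theory Defs
  imports "HOL-Probability.Probability"
begin

text \<open>
  The centred Gaussian law on \<open>real ^ 'd\<close>, given by its Lebesgue density.  It is meaningful for a
  positive definite covariance matrix only; all covariance matrices used below are of that kind.
\<close>

definition mvnormal_density :: "real ^ 'd ^ 'd \<Rightarrow> real ^ 'd \<Rightarrow> real" where
  "mvnormal_density S v =
     exp (- (v \<bullet> (matrix_inv S *v v)) / 2) / sqrt ((2 * pi) ^ CARD('d) * det S)"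

definition mvnormal :: "real ^ 'd ^ 'd \<Rightarrow> (real ^ 'd) measure" where
  "mvnormal S = density lborel (\<lambda>v. ennreal (mvnormal_density S v))"

text \<open>
  Noise of standard deviation \<open>\<sigma> \<ge> 0\<close>.  The case \<open>\<sigma> = 0\<close> is the point mass at \<open>0\<close> and has to be
  separated, since \<open>normal_density 0 0\<close> is the zero function.
\<close>

definition noise :: "real \<Rightarrow> real measure" where
  "noise \<sigma> = (if \<sigma> = 0 then return borel 0
              else density lborel (\<lambda>t. ennreal (normal_density 0 \<sigma> t)))"

definition task_cov :: "real ^ 'r ^ 'd \<Rightarrow> real \<Rightarrow> real ^ 'd ^ 'd" where
  "task_cov U \<epsilon> = U ** transpose U + \<epsilon> *\<^sub>R mat 1"

definition task_mixture :: "nat \<Rightarrow> (nat \<Rightarrow> real ^ 'r ^ 'd) \<Rightarrow> real \<Rightarrow> (real ^ 'd) measure" where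
  "task_mixture K U \<epsilon> =
     density lborel (\<lambda>v. ennreal (\<Sum>k=1..K. 1 / real K * mvnormal_density (task_cov (U k) \<epsilon>) v))"

text \<open>
  The joint law of \<open>(x, w, \<xi>)\<close> for a prompt of length \<open>n\<close> whose task vector has law \<open>\<mu>\<close>.
\<close>

definition data_law ::
  "real \<Rightarrow> (real ^ 'd) measure \<Rightarrow> nat \<Rightarrow>
    ((nat \<Rightarrow> real ^ 'd) \<times> (real ^ 'd) \<times> (nat \<Rightarrow> real)) measure" where
  "data_law \<sigma> \<mu> n =
     (\<Pi>\<^sub>M i\<in>{1..n+1}. mvnormal (mat 1)) \<Otimes>\<^sub>M \<mu> \<Otimes>\<^sub>M (\<Pi>\<^sub>M i\<in>{1..n+1}. noise \<sigma>)"

definition label :: "(nat \<Rightarrow> real ^ 'd) \<Rightarrow> real ^ 'd \<Rightarrow> (nat \<Rightarrow> real) \<Rightarrow> nat \<Rightarrow> real" where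
  "label x w \<xi> i = w \<bullet> x i + \<xi> i"

text \<open>
  Vectors of dimension \<open>d + 1\<close> are indexed by \<open>'d option\<close>, the index \<open>None\<close> being the last
  coordinate.  A matrix with \<open>n + 1\<close> rows is the function sending \<open>i \<in> {1..n+1}\<close> to its row \<open>i\<close>.
\<close>

definition prompt :: "nat \<Rightarrow> (nat \<Rightarrow> real ^ 'd) \<Rightarrow> (nat \<Rightarrow> real) \<Rightarrow> nat \<Rightarrow> real ^ ('d option)" where
  "prompt n x y i =
     (\<chi> j. case j of Some a \<Rightarrow> x i $ a | None \<Rightarrow> (if i = n + 1 then 0 else y i))"

definition mask :: "nat \<Rightarrow> (nat \<Rightarrow> real ^ 'a) \<Rightarrow> nat \<Rightarrow> real ^ 'a" where
  "mask n Z = Z(n + 1 := 0)"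

text \<open>The triple \<open>(W_Q, W_K, W_V)\<close>.\<close>

type_synonym 'd weights =
  "(real ^ ('d option) ^ ('d option)) \<times> (real ^ ('d option) ^ ('d option)) \<times>
   (real ^ ('d option) ^ ('d option))"

definition lin_attn :: "'d::finite weights \<Rightarrow> nat \<Rightarrow> (nat \<Rightarrow> real ^ ('d option)) \<Rightarrow> real" where
  "lin_attn W n Z =
     (case W of (W\<^sub>Q, W\<^sub>K, W\<^sub>V) \<Rightarrow>
        let score = (\<lambda>i. (Z (n + 1) v* (W\<^sub>Q ** transpose W\<^sub>K)) \<bullet> mask n Z i)
        in 1 / real n * ((\<Sum>i=1..n+1. score i *\<^sub>R mask n Z i) \<bullet> (W\<^sub>V *v axis None 1)))"

text \<open>
  Mean squared error at the query of the model with weights \<open>W\<close>, on prompts of length \<open>n\<close> with task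
  law \<open>\<mu>\<close>.  It serves both as the training loss and as the test risk.
\<close>

definition risk :: "real \<Rightarrow> (real ^ 'd::finite) measure \<Rightarrow> nat \<Rightarrow> 'd weights \<Rightarrow> real" where
  "risk \<sigma> \<mu> n W =
     (LINT (x, w, \<xi>)|data_law \<sigma> \<mu> n.
        (label x w \<xi> (n + 1) - lin_attn W n (prompt n x (label x w \<xi>)))\<^sup>2)"

definition optimal_weights :: "real \<Rightarrow> (real ^ 'd::finite) measure \<Rightarrow> nat \<Rightarrow> 'd weights \<Rightarrow> bool" where
  "optimal_weights \<sigma> \<mu> n W \<longleftrightarrow> is_arg_min (risk \<sigma> \<mu> n) (\<lambda>_. True) W"

end

theory Submission
  imports Defs
begin

text \<open>
  The prediction is \<open>x\<^sub>q \<bullet> (h\<^sub>o + h\<^sub>e)\<close>, where \<open>x\<^sub>q\<close> is the query, \<open>h\<^sub>o = C (1/n \<Sum> y\<^sub>i x\<^sub>i)\<close> is odd and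
  \<open>h\<^sub>e = 1/n \<Sum> ((u \<bullet> x\<^sub>i) B x\<^sub>i + y\<^sub>i\<^sup>2 e)\<close> is even under \<open>(w, \<xi>) \<mapsto> (- w, - \<xi>)\<close>; the matrices \<open>B\<close>, \<open>C\<close> and
  the vectors \<open>u\<close>, \<open>e\<close> are read off the weights.  The data law is invariant under this reflection, so
  the risk is \<open>\<sigma>\<^sup>2 + E|w - h\<^sub>o|\<^sup>2 + E|h\<^sub>e|\<^sup>2\<close>.  The middle term is a quadratic function of \<open>C\<close> given by
  the task covariance \<open>S\<close>, namely \<open>tr S - 2 (C \<bullet> S) + (C G) \<bullet> C\<close> with
  \<open>G = S + (S + (tr S + \<sigma>\<^sup>2) I) / n\<close>.  Hence \<open>C G = S\<close> at an optimum, and there \<open>h\<^sub>e\<close> vanishes almost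
  surely, which by the positivity of the task density forces \<open>h\<^sub>e = 0\<close> for prompts of every length.
  For the mixture, \<open>S = P / K + \<epsilon> I\<close> with \<open>P\<close> the orthogonal projection onto the sum of the task
  subspaces, and \<open>C\<close> tends to \<open>P\<close>, which fixes the test subspace.
\<close>

section \<open>Random variables with all moments\<close>

text \<open>Optimality does not determine the weights: scaling \<open>W\<^sub>Q\<close> up and
  \<open>W\<^sub>V\<close> down leaves the predictor unchanged. So only the quantities on which the
  prediction depends are extracted. The even part is delicate: optimality makes it vanish almost
  surely for training prompts, but test prompts have another length and another task law, so this
  has to become identities between \<open>B\<close>, \<open>u\<close> and \<open>e\<close>. The
  matrix G is the second moment of the average of the y_i x_i. Its 1/n correction comes from fourth
  Gaussian moments of repeated examples. It keeps G invertible as \<epsilon> tends to 0, when S may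
  become singular: tr S stays positive, even without noise. Hence the first limit is explicit for
  each n, and the optimal matrix becomes a multiple of P. The factor is below 1, a shrinkage caused
  by finite n, and tends to 1 as n grows. What is left of the test risk beyond \<sigma>^2 is
  estimation error of order 1/m.\<close>

definition all_moments :: "'a measure \<Rightarrow> ('a \<Rightarrow> real) \<Rightarrow> bool" where
  "all_moments M f \<longleftrightarrow> f \<in> borel_measurable M \<and> (\<forall>k. integrable M (\<lambda>x. \<bar>f x\<bar> ^ k))"

lemma all_moments_measurable: "all_moments M f \<Longrightarrow> f \<in> borel_measurable M"
  by (simp add: all_moments_def)

lemma all_moments_integrable_abs: "all_moments M f \<Longrightarrow> integrable M (\<lambda>x. \<bar>f x\<bar> ^ k)"
  by (simp add: all_moments_def)

lemma all_moments_integrable: "all_moments M f \<Longrightarrow> integrable M f"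
  using all_moments_integrable_abs[of M f 1] all_moments_measurable[of M f]
  by (simp add: integrable_abs_iff)

lemma (in finite_measure) all_moments_const: "all_moments M (\<lambda>_. c)"
  by (simp add: all_moments_def)

text \<open>Having all absolute moments, unlike mere integrability, survives multiplication: the
  pointwise bound below doubles the order, which costs nothing when every order is available.
  Integrability of any polynomial in the data thus reduces to moments of single coordinates.\<close>

lemma all_moments_mult:
  assumes "all_moments M f" "all_moments M g"
  shows "all_moments M (\<lambda>x. f x * g x)"
proof -
  note [measurable] = assms[THEN all_moments_measurable]
  have "integrable M (\<lambda>x. \<bar>f x * g x\<bar> ^ k)" for k
  proof (rule Bochner_Integration.integrable_bound)
    show "integrable M (\<lambda>x. \<bar>f x\<bar> ^ (2 * k) + \<bar>g x\<bar> ^ (2 * k))"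
      by (intro Bochner_Integration.integrable_add all_moments_integrable_abs assms)
    have "\<bar>a * b\<bar> ^ k \<le> \<bar>a\<bar> ^ (2 * k) + \<bar>b\<bar> ^ (2 * k)" for a b :: real
    proof -
      have "0 \<le> (\<bar>a\<bar> ^ k - \<bar>b\<bar> ^ k)\<^sup>2" by simp
      moreover have "\<bar>a * b\<bar> ^ k = \<bar>a\<bar> ^ k * \<bar>b\<bar> ^ k"
        by (simp add: abs_mult power_mult_distrib)
      moreover have "\<bar>a\<bar> ^ (2 * k) = (\<bar>a\<bar> ^ k)\<^sup>2" "\<bar>b\<bar> ^ (2 * k) = (\<bar>b\<bar> ^ k)\<^sup>2"
        by (simp_all flip: power_mult add: mult.commute)
      moreover have "0 \<le> \<bar>a\<bar> ^ k * \<bar>b\<bar> ^ k" by simp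
      ultimately show ?thesis unfolding power2_diff by linarith
    qed
    then show "AE x in M. norm (\<bar>f x * g x\<bar> ^ k) \<le> norm (\<bar>f x\<bar> ^ (2 * k) + \<bar>g x\<bar> ^ (2 * k))"
      by (intro AE_I2) (simp add: abs_of_nonneg)
  qed simp
  then show ?thesis by (simp add: all_moments_def)
qed

lemma all_moments_add:
  assumes "all_moments M f" "all_moments M g"
  shows "all_moments M (\<lambda>x. f x + g x)"
proof -
  note [measurable] = assms[THEN all_moments_measurable]
  have "integrable M (\<lambda>x. \<bar>f x + g x\<bar> ^ k)" for k
  proof (rule Bochner_Integration.integrable_bound)
    show "integrable M (\<lambda>x. 2 ^ k * (\<bar>f x\<bar> ^ k + \<bar>g x\<bar> ^ k))"
      by (intro integrable_mult_right Bochner_Integration.integrable_add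
            all_moments_integrable_abs assms)
    have "\<bar>a + b\<bar> ^ k \<le> 2 ^ k * (\<bar>a\<bar> ^ k + \<bar>b\<bar> ^ k)" for a b :: real
    proof -
      have "\<bar>a + b\<bar> \<le> 2 * max \<bar>a\<bar> \<bar>b\<bar>" by auto
      then have "\<bar>a + b\<bar> ^ k \<le> (2 * max \<bar>a\<bar> \<bar>b\<bar>) ^ k" by (intro power_mono) auto
      also have "\<dots> = 2 ^ k * max \<bar>a\<bar> \<bar>b\<bar> ^ k" by (simp add: power_mult_distrib)
      also have "max \<bar>a\<bar> \<bar>b\<bar> ^ k \<le> \<bar>a\<bar> ^ k + \<bar>b\<bar> ^ k" by (auto simp: max_def)
      finally show ?thesis by simp
    qed
    then show "AE x in M. norm (\<bar>f x + g x\<bar> ^ k) \<le> norm (2 ^ k * (\<bar>f x\<bar> ^ k + \<bar>g x\<bar> ^ k))"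
      by (intro AE_I2) (simp add: abs_of_nonneg)
  qed simp
  then show ?thesis by (simp add: all_moments_def)
qed

lemma (in finite_measure) all_moments_diff:
  assumes "all_moments M f" "all_moments M g"
  shows "all_moments M (\<lambda>x. f x - g x)"
  using all_moments_add[OF assms(1) all_moments_mult[OF all_moments_const assms(2)], of "-1"] by simp

lemma (in finite_measure) all_moments_sum:
  assumes "\<And>i. i \<in> I \<Longrightarrow> all_moments M (f i)"
  shows "all_moments M (\<lambda>x. \<Sum>i\<in>I. f i x)"
  using assms
  by (induction I rule: infinite_finite_induct) (simp_all add: all_moments_const all_moments_add)

lemma (in finite_measure) all_moments_power:
  assumes "all_moments M f"
  shows "all_moments M (\<lambda>x. f x ^ k)"
  by (induction k) (simp_all add: all_moments_const all_moments_mult assms)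

lemma all_moments_distr:
  assumes "T \<in> measurable M N" "f \<in> borel_measurable N"
  shows "all_moments (distr M N T) f \<longleftrightarrow> all_moments M (\<lambda>x. f (T x))"
proof -
  have "(\<lambda>x. f (T x)) \<in> borel_measurable M" using assms by measurable
  moreover have "integrable (distr M N T) (\<lambda>x. \<bar>f x\<bar> ^ k) \<longleftrightarrow> integrable M (\<lambda>x. \<bar>f (T x)\<bar> ^ k)" for k
    using assms by (intro integrable_distr_eq) simp_all
  ultimately show ?thesis using assms by (simp add: all_moments_def)
qed

lemma all_moments_fst:
  assumes "prob_space N" "all_moments M f"
  shows "all_moments (M \<Otimes>\<^sub>M N) (\<lambda>z. f (fst z))"
  using all_moments_distr[of fst "M \<Otimes>\<^sub>M N" M f] assms
  by (simp add: prob_space.distr_pair_fst all_moments_measurable)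

lemma distr_pair_snd:
  assumes "prob_space M" "sigma_finite_measure N"
  shows "distr (M \<Otimes>\<^sub>M N) N snd = N"
proof (rule measure_eqI)
  interpret M: prob_space M by fact
  interpret N: sigma_finite_measure N by fact
  fix A assume "A \<in> sets (distr (M \<Otimes>\<^sub>M N) N snd)"
  then have A: "A \<in> sets N" by simp
  have "snd -` A \<inter> space (M \<Otimes>\<^sub>M N) = space M \<times> A"
    using sets.sets_into_space[OF A] by (auto simp: space_pair_measure)
  then show "emeasure (distr (M \<Otimes>\<^sub>M N) N snd) A = emeasure N A"
    using A by (simp add: emeasure_distr N.emeasure_pair_measure_Times M.emeasure_space_1)
qed simp

lemma all_moments_snd:
  assumes "prob_space M" "sigma_finite_measure N" "all_moments N f"
  shows "all_moments (M \<Otimes>\<^sub>M N) (\<lambda>z. f (snd z))"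
  using all_moments_distr[of snd "M \<Otimes>\<^sub>M N" N f] assms
  by (simp add: distr_pair_snd all_moments_measurable)

lemma all_moments_PiM_component:
  assumes "finite I" "\<And>i. prob_space (M i)" "i \<in> I" "all_moments (M i) f"
  shows "all_moments (PiM I M) (\<lambda>x. f (x i))"
  using all_moments_distr[of "\<lambda>x. x i" "PiM I M" "M i" f] assms
  by (simp add: distr_PiM_component all_moments_measurable)

lemma (in prob_space) integral_zero_AE_square:
  assumes "all_moments M f" "(\<integral>x. (f x)\<^sup>2 \<partial>M) = 0"
  shows "AE x in M. f x = 0"
proof -
  have "AE x in M. (f x)\<^sup>2 = 0"
    using integral_nonneg_eq_0_iff_AE[of M "\<lambda>x. (f x)\<^sup>2"] assms
      all_moments_integrable[OF all_moments_power[OF assms(1), of 2]]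
    by simp
  then show ?thesis by simp
qed

section \<open>Independence as factorisation of integrals\<close>

lemma integral_PiM_factor:
  fixes f :: "('i \<Rightarrow> 'a) \<Rightarrow> real"
  assumes "finite I" "q \<in> I" "\<And>i. prob_space (M i)"
    and int1: "integrable (PiM I M) (\<lambda>x. g (x q) * f x)"
    and int2: "integrable (PiM I M) f"
    and indep: "\<And>x t. f (x(q := t)) = f x"
  shows "(\<integral>x. g (x q) * f x \<partial>PiM I M) = (\<integral>t. g t \<partial>M q) * (\<integral>x. f x \<partial>PiM I M)"
proof -
  interpret product_sigma_finite M
    using assms(3) by (simp add: product_sigma_finite_def prob_space_imp_sigma_finite)
  interpret Mq: prob_space "M q" by fact
  \<comment> \<open>Fubini splits off the coordinate \<open>q\<close>. Invariance of
    \<open>f\<close> under updates at \<open>q\<close> makes it constant in the inner integral, and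
    the total mass 1 of \<open>M q\<close> lets the coordinate be reinserted afterwards.\<close>
  define J where "J = I - {q}"
  have J: "I = insert q J" "finite J" "q \<notin> J" using assms by (auto simp: J_def)
  have "(\<integral>x. g (x q) * f x \<partial>PiM I M)
      = (\<integral>x. (\<integral>t. g ((x(q := t)) q) * f (x(q := t)) \<partial>M q) \<partial>PiM J M)"
    using int1 unfolding J(1) by (subst product_integral_insert[OF J(2,3)]) simp_all
  also have "\<dots> = (\<integral>t. g t \<partial>M q) * (\<integral>x. f x \<partial>PiM J M)"
    by (simp add: indep)
  also have "(\<integral>x. f x \<partial>PiM J M) = (\<integral>x. (\<integral>t. f (x(q := t)) \<partial>M q) \<partial>PiM J M)"
    by (simp add: indep Mq.prob_space)
  also have "\<dots> = (\<integral>x. f x \<partial>PiM I M)"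
    using int2 unfolding J(1) by (subst product_integral_insert[OF J(2,3)]) simp_all
  finally show ?thesis .
qed

text \<open>Feature and noise of one example lie in different factors of the data law, so the
  single-coordinate factorisation is applied twice, through nested Fubini integrals.\<close>

lemma integral_product_factor:
  fixes f :: "('i \<Rightarrow> 'a) \<times> 'b \<times> ('j \<Rightarrow> 'c) \<Rightarrow> real"
  assumes fin: "finite I" "q \<in> I" "finite J" "p \<in> J"
    and pX: "\<And>i. prob_space (X i)" and pN: "\<And>j. prob_space (N j)" and pm: "prob_space \<mu>"
  defines "M \<equiv> PiM I X \<Otimes>\<^sub>M \<mu> \<Otimes>\<^sub>M PiM J N"
  assumes g1: "all_moments (X q) g1" and g2: "all_moments (N p) g2" and f: "all_moments M f"
    and indep: "\<And>x w \<xi> s t. f (x(q := s), w, \<xi>(p := t)) = f (x, w, \<xi>)"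
  shows "(\<integral>(x, w, \<xi>). g1 (x q) * g2 (\<xi> p) * f (x, w, \<xi>) \<partial>M)
           = (\<integral>s. g1 s \<partial>X q) * (\<integral>t. g2 t \<partial>N p) * (\<integral>z. f z \<partial>M)"
proof -
  interpret PX: prob_space "PiM I X" by (intro prob_space_PiM pX)
  interpret PN: prob_space "PiM J N" by (intro prob_space_PiM pN)
  interpret mu: prob_space \<mu> by fact
  interpret B: pair_prob_space \<mu> "PiM J N" ..
  interpret A: pair_prob_space "PiM I X" "\<mu> \<Otimes>\<^sub>M PiM J N" ..
  have f1: "f (x(q := s), w, \<xi>) = f (x, w, \<xi>)" for x w \<xi> s
    using indep[of x s w \<xi> "\<xi> p"] by simp
  have f1': "f (x(q := s), z) = f (x, z)" for x z s
    using f1[of x s "fst z" "snd z"] by simp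
  have f2: "f (x, w, \<xi>(p := t)) = f (x, w, \<xi>)" for x w \<xi> t
    using indep[of x "x q" w \<xi> t] by simp
  have mg2: "all_moments (\<mu> \<Otimes>\<^sub>M PiM J N) (\<lambda>z. g2 (snd z p))"
    by (intro all_moments_snd[where f = "\<lambda>\<xi>. g2 (\<xi> p)"] all_moments_PiM_component fin pN g2
          mu.prob_space_axioms PN.sigma_finite_measure_axioms)
  have mg2': "all_moments M (\<lambda>z. g2 (snd (snd z) p))"
    unfolding M_def
    by (intro all_moments_snd[where f = "\<lambda>z. g2 (snd z p)"] mg2
          PX.prob_space_axioms B.sigma_finite_measure_axioms)
  have mg1: "all_moments M (\<lambda>z. g1 (fst z q))"
    unfolding M_def
    by (intro all_moments_fst[where f = "\<lambda>x. g1 (x q)"] all_moments_PiM_component fin pX g1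
          B.prob_space_axioms)
  have int_g2f: "integrable M (\<lambda>z. g2 (snd (snd z) p) * f z)"
    by (intro all_moments_integrable all_moments_mult mg2' f)
  have int_ggf: "integrable M (\<lambda>z. g1 (fst z q) * (g2 (snd (snd z) p) * f z))"
    by (intro all_moments_integrable all_moments_mult mg1 mg2' f)
  note int_f = all_moments_integrable[OF f]
  define F where "F x = (\<integral>z. f (x, z) \<partial>(\<mu> \<Otimes>\<^sub>M PiM J N))" for x
  \<comment> \<open>Fubini makes only almost every section integrable, so the noise factor comes out
    only for almost every \<open>x\<close>.\<close>
  have inner: "AE x in PiM I X. (\<integral>z. g2 (snd z p) * f (x, z) \<partial>(\<mu> \<Otimes>\<^sub>M PiM J N))
      = (\<integral>t. g2 t \<partial>N p) * F x"
    using A.AE_integrable_fst'[OF int_g2f[unfolded M_def]]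
      A.AE_integrable_fst'[OF int_f[unfolded M_def]]
  proof eventually_elim
    case (elim x)
    have "(\<integral>z. g2 (snd z p) * f (x, z) \<partial>(\<mu> \<Otimes>\<^sub>M PiM J N))
       = (\<integral>w. \<integral>\<xi>. g2 (\<xi> p) * f (x, w, \<xi>) \<partial>PiM J N \<partial>\<mu>)"
      using elim(1) by (subst B.integral_fst'[symmetric]) simp_all
    also have "\<dots> = (\<integral>w. (\<integral>t. g2 t \<partial>N p) * (\<integral>\<xi>. f (x, w, \<xi>) \<partial>PiM J N) \<partial>\<mu>)"
    proof (rule integral_cong_AE)
      show "AE w in \<mu>. (\<integral>\<xi>. g2 (\<xi> p) * f (x, w, \<xi>) \<partial>PiM J N)
          = (\<integral>t. g2 t \<partial>N p) * (\<integral>\<xi>. f (x, w, \<xi>) \<partial>PiM J N)"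
        using B.AE_integrable_fst'[OF elim(1)] B.AE_integrable_fst'[OF elim(2)]
        by eventually_elim (intro integral_PiM_factor fin pN f2, simp_all)
    next
      show "(\<lambda>w. \<integral>\<xi>. g2 (\<xi> p) * f (x, w, \<xi>) \<partial>PiM J N) \<in> borel_measurable \<mu>"
        using B.integrable_fst'[OF elim(1)] by (simp add: borel_measurable_integrable)
    next
      show "(\<lambda>w. (\<integral>t. g2 t \<partial>N p) * (\<integral>\<xi>. f (x, w, \<xi>) \<partial>PiM J N)) \<in> borel_measurable \<mu>"
        using B.integrable_fst'[OF elim(2)]
        by (intro borel_measurable_times) (simp_all add: borel_measurable_integrable)
    qed
    also have "\<dots> = (\<integral>t. g2 t \<partial>N p) * F x"
      unfolding F_def using elim(2) by (subst B.integral_fst'[symmetric]) simp_all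
    finally show ?case .
  qed
  have int_F: "integrable (PiM I X) F"
    unfolding F_def using A.integrable_fst'[OF int_f[unfolded M_def]] .
  have "integrable (PiM I X)
      (\<lambda>x. \<integral>z. g1 (x q) * (g2 (snd z p) * f (x, z)) \<partial>(\<mu> \<Otimes>\<^sub>M PiM J N))"
    using A.integrable_fst'[OF int_ggf[unfolded M_def]] by simp
  then have int_outer: "integrable (PiM I X)
      (\<lambda>x. g1 (x q) * (\<integral>z. g2 (snd z p) * f (x, z) \<partial>(\<mu> \<Otimes>\<^sub>M PiM J N)))"
    by simp
  have g1m: "(\<lambda>x. g1 (x q)) \<in> borel_measurable (PiM I X)"
    by (intro all_moments_measurable all_moments_PiM_component fin pX g1)
  have outer_AE: "AE x in PiM I X.
      g1 (x q) * (\<integral>z. g2 (snd z p) * f (x, z) \<partial>(\<mu> \<Otimes>\<^sub>M PiM J N))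
      = (\<integral>t. g2 t \<partial>N p) * (g1 (x q) * F x)"
    using inner by eventually_elim simp
  have Fm: "F \<in> borel_measurable (PiM I X)" using int_F by (rule borel_measurable_integrable)
  have "(\<integral>z. g1 (fst z q) * (g2 (snd (snd z) p) * f z) \<partial>M)
     = (\<integral>x. g1 (x q) * (\<integral>z. g2 (snd z p) * f (x, z) \<partial>(\<mu> \<Otimes>\<^sub>M PiM J N)) \<partial>PiM I X)"
    using int_ggf unfolding M_def by (subst A.integral_fst'[symmetric]) simp_all
  also have "\<dots> = (\<integral>x. (\<integral>t. g2 t \<partial>N p) * (g1 (x q) * F x) \<partial>PiM I X)"
    using outer_AE g1m Fm by (intro integral_cong_AE borel_measurable_integrable[OF int_outer]) auto
  also have "\<dots> = (\<integral>s. g1 s \<partial>X q) * (\<integral>t. g2 t \<partial>N p) * (\<integral>x. F x \<partial>PiM I X)"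
  \<comment> \<open>Integrability of \<open>g1 (x q) * F x\<close> is recovered by dividing by this
    constant; when the constant is zero, both sides vanish.\<close>
  proof (cases "(\<integral>t. g2 t \<partial>N p) = 0")
    case False
    have "integrable (PiM I X) (\<lambda>x. (\<integral>t. g2 t \<partial>N p) * (g1 (x q) * F x))"
      using outer_AE g1m Fm
      by (subst integrable_cong_AE[OF _ _ outer_AE, symmetric])
        (auto intro: int_outer borel_measurable_integrable[OF int_outer])
    then have "integrable (PiM I X) (\<lambda>x. g1 (x q) * F x)" using False by simp
    then have "(\<integral>x. g1 (x q) * F x \<partial>PiM I X) = (\<integral>s. g1 s \<partial>X q) * (\<integral>x. F x \<partial>PiM I X)"
      by (intro integral_PiM_factor fin pX int_F) (simp_all add: F_def f1')
    then show ?thesis by simp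
  qed simp
  also have "(\<integral>x. F x \<partial>PiM I X) = (\<integral>z. f z \<partial>M)"
    using int_f unfolding F_def M_def by (subst A.integral_fst'[symmetric]) simp_all
  finally show ?thesis by (simp add: split_def mult.assoc)
qed

section \<open>Linear change of variables for the Lebesgue measure\<close>

lemma Basis_cart: "(Basis :: (real ^ 'd) set) = range (\<lambda>i. axis i 1)"
  by (auto simp: Basis_vec_def)

lemma inj_axis: "inj (\<lambda>i :: 'd :: finite. axis i (1 :: real))"
  by (simp add: inj_on_def axis_eq_axis)

lemma prod_Basis_cart: "(\<Prod>b\<in>(Basis :: (real ^ 'd) set). f b) = (\<Prod>i\<in>UNIV. f (axis i 1))"
  by (simp add: Basis_cart prod.reindex inj_axis)

lemma measurable_matrix_vector_mult [measurable]:
  "(\<lambda>x. A *v x) \<in> borel_measurable borel" for A :: "real ^ 'n ^ 'm"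
  by (intro borel_measurable_continuous_onI matrix_vector_mult_linear_continuous_on)

lemma nn_integral_lborel_diagonal:
  fixes A :: "real ^ 'd ^ 'd" and F :: "real ^ 'd \<Rightarrow> ennreal"
  assumes diag: "\<And>i j. i \<noteq> j \<Longrightarrow> A $ i $ j = 0" and "det A \<noteq> 0"
    and F [measurable]: "F \<in> borel_measurable borel"
  shows "\<bar>det A\<bar> * (\<integral>\<^sup>+x. F (A *v x) \<partial>lborel) = (\<integral>\<^sup>+x. F x \<partial>lborel)"
proof -
  have det: "det A = (\<Prod>i\<in>UNIV. A $ i $ i)" using diag by (rule det_diagonal)
  then have nz: "A $ i $ i \<noteq> 0" for i using assms(2) by auto
  define c where "c b = b \<bullet> (A *v b)" for b
  have c: "c (axis i 1) = A $ i $ i" for i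
    by (simp add: c_def inner_axis' matrix_vector_mul_component inner_axis)
  have T: "(0 + (\<Sum>j\<in>Basis. (c j * (x \<bullet> j)) *\<^sub>R j)) = A *v x" for x
  proof -
    have "(\<Sum>j\<in>Basis. (c j * (x \<bullet> j)) *\<^sub>R j) $ i = A $ i $ i * x $ i" for i
      by (simp add: Basis_cart sum.reindex inj_axis c inner_axis)
        (simp add: axis_def if_distrib cong: if_cong)
    moreover have "(A *v x) $ i = A $ i $ i * x $ i" for i
    proof -
      have "(A *v x) $ i = (\<Sum>j\<in>UNIV. if j = i then A $ i $ i * x $ i else 0)"
        unfolding matrix_vector_mult_def vec_lambda_beta
        by (rule sum.cong) (use diag in auto)
      then show ?thesis by simp
    qed
    ultimately show ?thesis by (simp add: vec_eq_iff)
  qed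
  have nzc: "c b \<noteq> 0" if "b \<in> Basis" for b
    using that nz c by (auto simp: Basis_cart)
  have "lborel = density (distr lborel borel ((*v) A)) (\<lambda>_. ennreal (\<Prod>j\<in>Basis. \<bar>c j\<bar>))"
    using lborel_affine_euclidean[of c 0, OF nzc] unfolding T by simp
  moreover have "(\<Prod>j\<in>Basis. \<bar>c j\<bar>) = \<bar>det A\<bar>"
    by (simp add: prod_Basis_cart c det abs_prod)
  ultimately have "lborel = density (distr lborel borel ((*v) A)) (\<lambda>_. ennreal \<bar>det A\<bar>)"
    by simp
  then have "(\<integral>\<^sup>+x. F x \<partial>lborel)
      = (\<integral>\<^sup>+x. F x \<partial>density (distr lborel borel ((*v) A)) (\<lambda>_. ennreal \<bar>det A\<bar>))"
    by simp
  also have "\<dots> = \<bar>det A\<bar> * (\<integral>\<^sup>+x. F (A *v x) \<partial>lborel)"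
    by (simp add: nn_integral_density nn_integral_distr nn_integral_cmult)
  finally show ?thesis by simp
qed

text \<open>Permuting coordinates sends boxes to boxes with permuted side lengths, and the Lebesgue
  measure is determined by its values on boxes.\<close>

lemma nn_integral_lborel_swap:
  fixes F :: "real ^ 'd \<Rightarrow> ennreal"
  assumes F [measurable]: "F \<in> borel_measurable borel" and p: "p permutes UNIV"
  shows "(\<integral>\<^sup>+x. F (\<chi> i. x $ p i) \<partial>lborel) = (\<integral>\<^sup>+x. F x \<partial>lborel)"
proof -
  let ?f = "\<lambda>x :: real ^ 'd. \<chi> i. x $ p i"
  have "linear ?f"
    by (rule linearI) (simp_all add: vec_eq_iff)
  then have [measurable]: "?f \<in> borel_measurable borel"
    by (intro borel_measurable_continuous_onI linear_continuous_on linear_conv_bounded_linear[THEN iffD1])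
  note bij = permutes_bij[OF p]
  have inv: "p (inv p i) = i" "inv p (p i) = i" for i
    using permutes_inverses[OF p] by auto
  have "lborel = distr lborel borel ?f"
  proof (rule lborel_eqI)
    fix l u :: "real ^ 'd"
    assume le: "\<And>b. b \<in> Basis \<Longrightarrow> l \<bullet> b \<le> u \<bullet> b"
    have le': "l $ i \<le> u $ i" for i
      using le[of "axis i 1"] by (simp add: Basis_cart inner_axis)
    have "?f -` box l u = box (\<chi> i. l $ inv p i) (\<chi> i. u $ inv p i)"
      unfolding set_eq_iff by (auto simp: mem_box_cart) (metis inv(1), metis inv(1), metis inv(2), metis inv(2))
    then have "emeasure (distr lborel borel ?f) (box l u)
        = emeasure lborel (box (\<chi> i. l $ inv p i) (\<chi> i. u $ inv p i))"
      by (simp add: emeasure_distr)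
    also have "\<dots> = (\<Prod>b\<in>Basis. ((\<chi> i. u $ inv p i) - (\<chi> i. l $ inv p i)) \<bullet> b)"
      by (rule emeasure_lborel_box) (auto simp: Basis_cart inner_axis le')
    also have "(\<Prod>b\<in>Basis. ((\<chi> i. u $ inv p i) - (\<chi> i. l $ inv p i)) \<bullet> b)
        = (\<Prod>i\<in>UNIV. u $ inv p i - l $ inv p i)"
      by (simp add: prod_Basis_cart inner_axis)
    also have "\<dots> = (\<Prod>i\<in>UNIV. u $ i - l $ i)"
      using prod.permute[OF permutes_inv[OF p], of "\<lambda>i. u $ i - l $ i"] by (simp add: o_def)
    also have "\<dots> = (\<Prod>b\<in>Basis. (u - l) \<bullet> b)"
      by (simp add: prod_Basis_cart inner_axis)
    finally show "emeasure (distr lborel borel ?f) (box l u) = (\<Prod>b\<in>Basis. (u - l) \<bullet> b)" .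
  qed simp
  then have "(\<integral>\<^sup>+x. F x \<partial>lborel) = (\<integral>\<^sup>+x. F x \<partial>distr lborel borel ?f)" by simp
  then show ?thesis by (simp add: nn_integral_distr)
qed

text \<open>With all coordinates except the \<open>m\<close>-th held fixed, the shear translates
  that one coordinate, and one-dimensional Lebesgue measure is translation invariant.\<close>

lemma nn_integral_lborel_shear:
  fixes F :: "real ^ 'd \<Rightarrow> ennreal"
  assumes F [measurable]: "F \<in> borel_measurable borel" and "m \<noteq> n"
  shows "(\<integral>\<^sup>+x. F (x + axis m (x $ n)) \<partial>lborel) = (\<integral>\<^sup>+x. F x \<partial>lborel)"
proof -
  interpret product_sigma_finite "\<lambda>_ :: real ^ 'd. lborel :: real measure"
    by standard
  define J where "J = (Basis :: (real ^ 'd) set) - {axis m 1}"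
  have J: "Basis = insert (axis m 1) J" "finite J" "axis m 1 \<notin> J" "axis n 1 \<in> J"
    using assms(2) by (auto simp: J_def Basis_cart axis_eq_axis)
  define \<Phi> :: "((real ^ 'd) \<Rightarrow> real) \<Rightarrow> real ^ 'd" where "\<Phi> g = (\<Sum>b\<in>Basis. g b *\<^sub>R b)" for g
  have \<Phi>m [measurable]: "\<Phi> \<in> borel_measurable (PiM Basis (\<lambda>_. lborel))"
    unfolding \<Phi>_def by measurable
  have \<Phi>m': "\<Phi> \<in> borel_measurable (PiM (insert (axis m 1) J) (\<lambda>_. lborel))"
    using \<Phi>m unfolding J(1) .
  have nth: "\<Phi> g $ i = g (axis i 1)" for g i
    unfolding \<Phi>_def by (simp add: Basis_cart sum.reindex inj_axis)
      (simp add: axis_def if_distrib cong: if_cong)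
  \<comment> \<open>The factor 1 gives the shape of a one-dimensional affine substitution.\<close>
  have shear: "\<Phi> (g(axis m 1 := y)) + axis m (\<Phi> (g(axis m 1 := y)) $ n)
      = \<Phi> (g(axis m 1 := g (axis n 1) + 1 * y))" for g y
    using assms(2) by (simp add: vec_eq_iff nth axis_eq_axis) (auto simp: axis_def)
  have Fshear: "(\<lambda>x. F (x + axis m (x $ n))) \<in> borel_measurable borel"
  proof -
    have "linear (\<lambda>x :: real ^ 'd. x + axis m (x $ n))"
      by (rule linearI) (auto simp: vec_eq_iff axis_def algebra_simps)
    then have "(\<lambda>x :: real ^ 'd. x + axis m (x $ n)) \<in> borel_measurable borel"
      by (intro borel_measurable_continuous_onI linear_continuous_on linear_conv_bounded_linear[THEN iffD1])
    then show ?thesis by measurable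
  qed
  have upd: "(\<lambda>y. \<Phi> (g(axis m 1 := y))) \<in> borel_measurable borel" for g
    unfolding \<Phi>_def fun_upd_def by measurable
  have fold: "(\<integral>\<^sup>+x. G x \<partial>lborel)
      = (\<integral>\<^sup>+g. \<integral>\<^sup>+y. G (\<Phi> (g(axis m 1 := y))) \<partial>lborel \<partial>PiM J (\<lambda>_. lborel))"
    if [measurable]: "G \<in> borel_measurable borel" for G :: "real ^ 'd \<Rightarrow> ennreal"
  proof -
    have "(\<integral>\<^sup>+x. G x \<partial>lborel) = (\<integral>\<^sup>+x. G (\<Phi> x) \<partial>PiM Basis (\<lambda>_. lborel))"
      unfolding lborel_eq[where 'a = "real ^ 'd"] \<Phi>_def by (subst nn_integral_distr) measurable
    also have "\<dots> = (\<integral>\<^sup>+g. \<integral>\<^sup>+y. G (\<Phi> (g(axis m 1 := y))) \<partial>lborel \<partial>PiM J (\<lambda>_. lborel))"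
      unfolding J(1)
      by (rule product_nn_integral_insert[OF J(2,3)]) (intro measurable_compose[OF \<Phi>m' that])
    finally show ?thesis .
  qed
  have "(\<integral>\<^sup>+y. F (\<Phi> (g(axis m 1 := y))) \<partial>lborel)
      = (\<integral>\<^sup>+y. F (\<Phi> (g(axis m 1 := g (axis n 1) + 1 * y))) \<partial>lborel)" for g
    using nn_integral_real_affine[of "\<lambda>y. F (\<Phi> (g(axis m 1 := y)))" 1 "g (axis n 1)"]
      measurable_compose[OF upd F] by simp
  then show ?thesis
    unfolding fold[OF F] fold[OF Fshear] shear by simp
qed

text \<open>
  The library states the change of variables for linear maps only for index types in the class
  \<open>wellorder\<close>, which the dimension \<open>'d\<close> does not have.
\<close>

lemma nn_integral_lborel_linear:
  fixes A :: "real ^ 'd ^ 'd" and F :: "real ^ 'd \<Rightarrow> ennreal"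
  assumes "det A \<noteq> 0" and "F \<in> borel_measurable borel"
  shows "\<bar>det A\<bar> * (\<integral>\<^sup>+x. F (A *v x) \<partial>lborel) = (\<integral>\<^sup>+x. F x \<partial>lborel)"
proof -
  \<comment> \<open>The predicate ranges over all \<open>F\<close>, because the product case applies
    it to the composition of \<open>F\<close> with a matrix. With \<open>det A \<noteq> 0\<close> as
    an inner premise, matrices with a zero row are trivial cases of the induction.\<close>
  define Q :: "real ^ 'd ^ 'd \<Rightarrow> bool" where
    "Q A \<longleftrightarrow> (det A \<noteq> 0 \<longrightarrow> (\<forall>F :: real ^ 'd \<Rightarrow> ennreal. F \<in> borel_measurable borel \<longrightarrow>
       \<bar>det A\<bar> * (\<integral>\<^sup>+x. F (A *v x) \<partial>lborel) = (\<integral>\<^sup>+x. F x \<partial>lborel)))" for A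
  have "Q A"
  proof (rule induct_matrix_elementary_alt)
    fix A B :: "real ^ 'd ^ 'd"
    assume "Q A" "Q B"
    show "Q (A ** B)"
      unfolding Q_def
    proof (intro impI allI)
      fix F :: "real ^ 'd \<Rightarrow> ennreal"
      assume nz: "det (A ** B) \<noteq> 0" and F [measurable]: "F \<in> borel_measurable borel"
      have "(\<lambda>x. F (A *v x)) \<in> borel_measurable borel" by measurable
      then have B: "\<bar>det B\<bar> * (\<integral>\<^sup>+x. F (A *v (B *v x)) \<partial>lborel) = (\<integral>\<^sup>+x. F (A *v x) \<partial>lborel)"
        using \<open>Q B\<close> nz
        unfolding Q_def by (elim impE allE[where x = "\<lambda>x. F (A *v x)"]) (simp_all add: det_mul)
      have "ennreal \<bar>det (A ** B)\<bar> = ennreal \<bar>det A\<bar> * ennreal \<bar>det B\<bar>"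
        by (simp add: det_mul abs_mult ennreal_mult)
      then have "\<bar>det (A ** B)\<bar> * (\<integral>\<^sup>+x. F ((A ** B) *v x) \<partial>lborel)
          = \<bar>det A\<bar> * (\<integral>\<^sup>+x. F (A *v x) \<partial>lborel)"
        by (simp add: B[symmetric] matrix_vector_mul_assoc mult.assoc)
      also have "\<dots> = (\<integral>\<^sup>+x. F x \<partial>lborel)"
        using \<open>Q A\<close> nz F by (auto simp: Q_def det_mul)
      finally show "\<bar>det (A ** B)\<bar> * (\<integral>\<^sup>+x. F ((A ** B) *v x) \<partial>lborel) = (\<integral>\<^sup>+x. F x \<partial>lborel)" .
    qed
  next
    fix A :: "real ^ 'd ^ 'd" and i
    assume "row i A = 0"
    then show "Q A" by (auto simp: Q_def det_zero_row)
  next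
    fix A :: "real ^ 'd ^ 'd"
    assume "\<And>i j. i \<noteq> j \<Longrightarrow> A $ i $ j = 0"
    then show "Q A" by (auto simp: Q_def intro: nn_integral_lborel_diagonal)
  next
    fix m n :: 'd
    assume "m \<noteq> n"
    let ?p = "Transposition.transpose m n"
    let ?S = "\<chi> i j. (mat 1 :: real ^ 'd ^ 'd) $ i $ ?p j"
    have p: "?p permutes UNIV" by (rule permutes_swap_id) auto
    have "?S *v x = (\<chi> i. x $ ?p i)" for x :: "real ^ 'd"
    proof -
      have "(\<Sum>j\<in>UNIV. (if i = ?p j then 1 else 0) * x $ j) = x $ ?p i" for i
      proof -
        have "(\<Sum>j\<in>UNIV. (if i = ?p j then 1 else 0) * x $ j)
            = (\<Sum>j\<in>UNIV. if j = ?p i then x $ j else 0)"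
          by (intro sum.cong) (auto simp: transpose_eq_iff)
        then show ?thesis by simp
      qed
      then show ?thesis by (simp add: matrix_vector_mult_def mat_def vec_eq_iff)
    qed
    moreover have "\<bar>det ?S\<bar> = 1"
      using det_permute_columns[OF p, of "mat 1 :: real ^ 'd ^ 'd"] by (simp add: sign_swap_id)
    ultimately show "Q ?S"
      by (simp add: Q_def nn_integral_lborel_swap[OF _ p])
  next
    fix m n :: 'd
    assume mn: "m \<noteq> n"
    let ?S = "(\<chi> i j. of_bool (i = m \<and> j = n \<or> i = j)) :: real ^ 'd ^ 'd"
    have "?S *v x = x + axis m (x $ n)" for x :: "real ^ 'd"
    proof -
      have "(\<Sum>j\<in>UNIV. of_bool (i = m \<and> j = n \<or> i = j) * x $ j) = x $ i + (if i = m then x $ n else 0)" for i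
      proof -
        have "(\<Sum>j\<in>UNIV. of_bool (i = m \<and> j = n \<or> i = j) * x $ j)
            = (\<Sum>j\<in>UNIV. (if j = i then x $ j else 0) + (if j = n then if i = m then x $ j else 0 else 0))"
          using mn by (intro sum.cong) auto
        then show ?thesis by (simp add: sum.distrib)
      qed
      then show ?thesis by (simp add: matrix_vector_mult_def vec_eq_iff axis_def)
    qed
    moreover have "det ?S = 1"
    proof -
      \<comment> \<open>The shear matrix is the identity after one row addition, which preserves the
        determinant.\<close>
      have "?S = (\<chi> k. if k = m then row m (mat 1) + 1 *s row n (mat 1) else row k (mat 1))"
        using mn by (auto simp: vec_eq_iff row_def mat_def)
      then show ?thesis using det_row_operation[OF mn, of "mat 1" 1] by simp
    qed
    ultimately show "Q ?S"
      by (simp add: Q_def nn_integral_lborel_shear[OF _ mn])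
  qed
  then show ?thesis using assms by (auto simp: Q_def)
qed

section \<open>Gaussian laws\<close>

lemma lborel_product:
  fixes f :: "'d :: finite \<Rightarrow> real \<Rightarrow> real"
  assumes "\<And>i. integrable lborel (f i)"
  shows integrable_lborel_product: "integrable lborel (\<lambda>x :: real ^ 'd. \<Prod>i\<in>UNIV. f i (x $ i))"
    and integral_lborel_product:
      "(\<integral>x. (\<Prod>i\<in>UNIV. f i (x $ i)) \<partial>(lborel :: (real ^ 'd) measure)) = (\<Prod>i\<in>UNIV. \<integral>t. f i t \<partial>lborel)"
proof -
  interpret product_sigma_finite "\<lambda>_ :: real ^ 'd. lborel :: real measure"
    by standard
  define ix where "ix = inv (\<lambda>i :: 'd. axis i (1 :: real))"
  have ix: "ix (axis i 1) = i" for i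
    unfolding ix_def by (rule inv_f_f[OF inj_axis])
  define \<Phi> :: "((real ^ 'd) \<Rightarrow> real) \<Rightarrow> real ^ 'd" where "\<Phi> g = (\<Sum>b\<in>Basis. g b *\<^sub>R b)" for g
  have \<Phi>m [measurable]: "\<Phi> \<in> borel_measurable (PiM Basis (\<lambda>_. lborel))"
    unfolding \<Phi>_def by measurable
  have nth: "\<Phi> g $ i = g (axis i 1)" for g i
    unfolding \<Phi>_def by (simp add: Basis_cart sum.reindex inj_axis)
      (simp add: axis_def if_distrib cong: if_cong)
  have eq: "(\<Prod>i\<in>UNIV. f i (\<Phi> g $ i)) = (\<Prod>b\<in>Basis. f (ix b) (g b))" for g
    by (simp add: nth prod_Basis_cart ix)
  have lb: "(lborel :: (real ^ 'd) measure) = distr (PiM Basis (\<lambda>_. lborel)) borel \<Phi>"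
    unfolding \<Phi>_def by (rule lborel_eq)
  have fm [measurable]: "f i \<in> borel_measurable borel" for i
    using borel_measurable_integrable[OF assms[of i]] by simp
  have "integrable (PiM Basis (\<lambda>_. lborel)) (\<lambda>g. \<Prod>i\<in>UNIV. f i (\<Phi> g $ i))"
    unfolding eq by (rule product_integrable_prod) (simp_all add: assms)
  then show "integrable lborel (\<lambda>x :: real ^ 'd. \<Prod>i\<in>UNIV. f i (x $ i))"
    unfolding lb by (subst integrable_distr_eq) simp_all
  have "(\<integral>x. (\<Prod>i\<in>UNIV. f i (x $ i)) \<partial>(lborel :: (real ^ 'd) measure))
      = (\<integral>g. (\<Prod>b\<in>Basis. f (ix b) (g b)) \<partial>PiM Basis (\<lambda>_. lborel))"
    unfolding lb by (subst integral_distr) (simp_all add: eq)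
  also have "\<dots> = (\<Prod>b\<in>Basis. \<integral>t. f (ix b) t \<partial>lborel)"
    by (rule product_integral_prod) (simp_all add: assms)
  also have "\<dots> = (\<Prod>i\<in>UNIV. \<integral>t. f i t \<partial>lborel)"
    by (simp add: prod_Basis_cart ix)
  finally show "(\<integral>x. (\<Prod>i\<in>UNIV. f i (x $ i)) \<partial>(lborel :: (real ^ 'd) measure))
      = (\<Prod>i\<in>UNIV. \<integral>t. f i t \<partial>lborel)" .
qed

lemma measurable_mvnormal_density [measurable]: "mvnormal_density S \<in> borel_measurable borel"
  unfolding mvnormal_density_def by measurable

lemma sets_mvnormal [simp, measurable_cong]: "sets (mvnormal S) = sets borel"
  by (simp add: mvnormal_def)

lemma space_mvnormal [simp]: "space (mvnormal S) = UNIV"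
  by (simp add: mvnormal_def)

lemma mvnormal_density_nonneg: "0 \<le> mvnormal_density S v" if "0 \<le> det S"
  using that by (simp add: mvnormal_density_def)

lemma mvnormal_density_pos: "0 < mvnormal_density S v" if "0 < det S"
  using that by (simp add: mvnormal_density_def)

lemma matrix_inv_right:
  fixes A :: "real ^ 'd ^ 'd"
  assumes "det A \<noteq> 0"
  shows "A ** matrix_inv A = mat 1"
proof -
  have "\<exists>B. A ** B = mat 1 \<and> B ** A = mat 1"
    using assms by (simp add: invertible_det_nz[symmetric] invertible_def)
  then show ?thesis unfolding matrix_inv_def by (rule someI2_ex) simp
qed

lemma matrix_inv_mat_1 [simp]: "matrix_inv (mat 1 :: real ^ 'd ^ 'd) = mat 1"
  using matrix_inv_right[of "mat 1 :: real ^ 'd ^ 'd"] by simp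

lemma mvnormal_density_mat_1:
  "mvnormal_density (mat 1 :: real ^ 'd ^ 'd) v = (\<Prod>i\<in>UNIV. std_normal_density (v $ i))"
proof -
  have "(\<Prod>i\<in>UNIV. std_normal_density (v $ i))
      = (\<Prod>i\<in>(UNIV :: 'd set). exp (- (v $ i)\<^sup>2 / 2)) / sqrt (2 * pi) ^ CARD('d)"
    by (simp add: std_normal_density_def prod_dividef)
  also have "(\<Prod>i\<in>(UNIV :: 'd set). exp (- (v $ i)\<^sup>2 / 2)) = exp (- (v \<bullet> v) / 2)"
    by (simp add: inner_vec_def power2_eq_square sum_negf sum_divide_distrib flip: exp_sum)
  moreover have "sqrt ((2 * pi) ^ CARD('d) * det (mat 1 :: real ^ 'd ^ 'd)) = sqrt (2 * pi) ^ CARD('d)"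
    by (simp only: det_I mult_1_right real_sqrt_power)
  ultimately show ?thesis
    unfolding mvnormal_density_def by simp
qed

lemma integrable_mvnormal_iff:
  fixes f :: "real ^ 'd \<Rightarrow> real"
  assumes "0 \<le> det S" and [measurable]: "f \<in> borel_measurable borel"
  shows "integrable (mvnormal S) f \<longleftrightarrow> integrable lborel (\<lambda>v. mvnormal_density S v * f v)"
  unfolding mvnormal_def using assms
  by (subst integrable_density) (auto intro: mvnormal_density_nonneg)

lemma integral_mvnormal:
  fixes f :: "real ^ 'd \<Rightarrow> real"
  assumes "0 \<le> det S" and [measurable]: "f \<in> borel_measurable borel"
  shows "(\<integral>v. f v \<partial>mvnormal S) = (\<integral>v. mvnormal_density S v * f v \<partial>lborel)"
  unfolding mvnormal_def using assms
  by (subst integral_density) (auto intro: mvnormal_density_nonneg)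

lemma mvnormal_mat_1_product:
  fixes f :: "'d :: finite \<Rightarrow> real \<Rightarrow> real"
  assumes [measurable]: "\<And>i. f i \<in> borel_measurable borel"
    and int: "\<And>i. integrable lborel (\<lambda>t. std_normal_density t * f i t)"
  shows integrable_mvnormal_mat_1_product:
      "integrable (mvnormal (mat 1 :: real ^ 'd ^ 'd)) (\<lambda>v. \<Prod>i\<in>UNIV. f i (v $ i))"
    and integral_mvnormal_mat_1_product:
      "(\<integral>v. (\<Prod>i\<in>UNIV. f i (v $ i)) \<partial>mvnormal (mat 1 :: real ^ 'd ^ 'd))
         = (\<Prod>i\<in>UNIV. \<integral>t. std_normal_density t * f i t \<partial>lborel)"
  using integrable_lborel_product[of "\<lambda>i t. std_normal_density t * f i t"] int
    integral_lborel_product[of "\<lambda>i t. std_normal_density t * f i t"]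
  by (simp_all add: integrable_mvnormal_iff integral_mvnormal mvnormal_density_mat_1 prod.distrib)

lemma prob_space_mvnormal_mat_1: "prob_space (mvnormal (mat 1 :: real ^ 'd ^ 'd))"
proof
  have "integrable lborel (mvnormal_density (mat 1 :: real ^ 'd ^ 'd))"
    "(\<integral>v. mvnormal_density (mat 1 :: real ^ 'd ^ 'd) v \<partial>lborel) = 1"
    using integrable_lborel_product[of "\<lambda>_ :: 'd. std_normal_density"]
      integral_lborel_product[of "\<lambda>_ :: 'd. std_normal_density"]
      integrable_std_normal_moment[of 0] integral_std_normal_moment_even[of 0]
    by (simp_all add: mvnormal_density_mat_1[abs_def])
  then have "(\<integral>\<^sup>+v. mvnormal_density (mat 1 :: real ^ 'd ^ 'd) v \<partial>lborel) = 1"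
    by (subst nn_integral_eq_integral) (simp_all add: mvnormal_density_nonneg)
  then show "emeasure (mvnormal (mat 1 :: real ^ 'd ^ 'd)) (space (mvnormal (mat 1 :: real ^ 'd ^ 'd))) = 1"
    by (simp add: mvnormal_def emeasure_density)
qed

lemma all_moments_mvnormal_mat_1: "all_moments (mvnormal (mat 1 :: real ^ 'd ^ 'd)) (\<lambda>v. v $ a)"
proof -
  have "integrable (mvnormal (mat 1 :: real ^ 'd ^ 'd)) (\<lambda>v. \<bar>v $ a\<bar> ^ k)" for k
  proof -
    have "integrable (mvnormal (mat 1 :: real ^ 'd ^ 'd))
        (\<lambda>v. \<Prod>i\<in>UNIV. (if i = a then \<bar>v $ i\<bar> ^ k else 1))"
    proof (rule integrable_mvnormal_mat_1_product[where f = "\<lambda>i t. if i = a then \<bar>t\<bar> ^ k else 1"])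
      show "integrable lborel (\<lambda>t. std_normal_density t * (if i = a then \<bar>t\<bar> ^ k else 1))" for i
        using integrable_std_normal_moment_abs[of k] integrable_std_normal_moment[of 0]
        by (cases "i = a") simp_all
    qed simp
    then show ?thesis by simp
  qed
  then show ?thesis by (simp add: all_moments_def)
qed

definition std_moment :: "nat \<Rightarrow> real" where
  "std_moment k = (\<integral>t. std_normal_density t * t ^ k \<partial>lborel)"

lemma std_moment_simps [simp]:
  "std_moment 0 = 1" "std_moment (Suc 0) = 0" "std_moment 2 = 1" "std_moment 3 = 0" "std_moment 4 = 3"
  using integral_std_normal_moment_even[of 0] integral_std_normal_moment_odd[of 0]
    integral_std_normal_moment_even[of 1] integral_std_normal_moment_odd[of 1]
    integral_std_normal_moment_even[of 2]
  by (simp_all add: std_moment_def fact_numeral numeral_3_eq_3)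

lemma prod_list_components:
  fixes v :: "real ^ 'd"
  shows "prod_list (map (\<lambda>a. v $ a) L) = (\<Prod>i\<in>UNIV. (v $ i) ^ count_list L i)"
proof (induction L)
  case (Cons a L)
  have "(\<Prod>i\<in>UNIV. (v $ i) ^ count_list (a # L) i)
      = (\<Prod>i\<in>UNIV. (if i = a then v $ i else 1) * (v $ i) ^ count_list L i)"
    by (intro prod.cong) auto
  also have "\<dots> = v $ a * (\<Prod>i\<in>UNIV. (v $ i) ^ count_list L i)"
    by (simp add: prod.distrib)
  finally show ?case using Cons by simp
qed simp

text \<open>Grouping equal indices turns the monomial into powers of separate coordinates, whose
  integral factors over the product density. Indices outside the list contribute the zeroth moment
  1.\<close>

lemma integral_mvnormal_mat_1_monomial:
  "(\<integral>v. prod_list (map (\<lambda>a. v $ a) L) \<partial>mvnormal (mat 1 :: real ^ 'd ^ 'd))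
     = (\<Prod>i\<in>set L. std_moment (count_list L i))"
proof -
  have "(\<integral>v. prod_list (map (\<lambda>a. v $ a) L) \<partial>mvnormal (mat 1 :: real ^ 'd ^ 'd))
      = (\<Prod>i\<in>UNIV. std_moment (count_list L i))"
    unfolding prod_list_components std_moment_def
    by (rule integral_mvnormal_mat_1_product) (simp_all add: integrable_std_normal_moment)
  also have "\<dots> = (\<Prod>i\<in>set L. std_moment (count_list L i))"
    by (intro prod.mono_neutral_right) (auto simp: count_list_0_iff)
  finally show ?thesis .
qed

lemma mvnormal_mat_1_moment_2:
  "(\<integral>v. v $ a * v $ b \<partial>mvnormal (mat 1 :: real ^ 'd ^ 'd)) = of_bool (a = b)"
  using integral_mvnormal_mat_1_monomial[of "[a, b]"] std_moment_simps(3)[unfolded numeral_2_eq_2]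
  by (cases "a = b") simp_all

text \<open>Isserlis' formula, one term for each pairing of the four indices. The proof runs through
  the equality patterns; when all indices coincide, the three pairings add up to the fourth moment
  3.\<close>

lemma mvnormal_mat_1_moment_4:
  "(\<integral>v. v $ a * v $ b * v $ c * v $ e \<partial>mvnormal (mat 1 :: real ^ 'd ^ 'd))
     = of_bool (a = b \<and> c = e) + of_bool (a = c \<and> b = e) + of_bool (a = e \<and> b = c)"
proof -
  have m: "std_moment (Suc (Suc 0)) = 1" "std_moment (Suc (Suc (Suc 0))) = 0"
    "std_moment (Suc (Suc (Suc (Suc 0)))) = 3"
    using std_moment_simps(3-5) by (simp_all add: eval_nat_numeral del: std_moment_simps)
  have "(\<integral>v. v $ a * v $ b * v $ c * v $ e \<partial>mvnormal (mat 1 :: real ^ 'd ^ 'd))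
      = (\<Prod>i\<in>{a, b, c, e}. std_moment (count_list [a, b, c, e] i))"
    using integral_mvnormal_mat_1_monomial[of "[a, b, c, e]"] by (simp add: mult.assoc)
  also have "\<dots> = of_bool (a = b \<and> c = e) + of_bool (a = c \<and> b = e) + of_bool (a = e \<and> b = c)"
    using m
    by (cases "a = b"; cases "a = c"; cases "a = e"; cases "b = c"; cases "b = e"; cases "c = e")
      (simp_all add: insert_absorb)
  finally show ?thesis .
qed

text \<open>Transfers normalisation and moments from the standard Gaussian, in place of integrals
  against a general covariance.\<close>

lemma mvnormal_linear_image:
  fixes A :: "real ^ 'd ^ 'd"
  assumes "det A \<noteq> 0"
  shows "mvnormal (A ** transpose A) = distr (mvnormal (mat 1)) borel ((*v) A)"
proof (rule measure_eqI)
  let ?S = "A ** transpose A"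
  have det: "det ?S = (det A)\<^sup>2" by (simp add: det_mul power2_eq_square)
  then have inv: "det ?S \<noteq> 0" using assms by simp
  have quad: "(A *v x) \<bullet> (matrix_inv ?S *v (A *v x)) = x \<bullet> x" for x
  proof -
    \<comment> \<open>No formula for the inverse is needed: \<open>y\<close> solves
      \<open>?S *v y = A *v x\<close>, and cancelling the injective \<open>A\<close> leaves
      \<open>transpose A *v y = x\<close>.\<close>
    define y where "y = matrix_inv ?S *v (A *v x)"
    have "?S *v y = A *v x"
      using matrix_inv_right[OF inv] by (simp add: y_def matrix_vector_mul_assoc matrix_mul_assoc)
    then have "A *v (transpose A *v y) = A *v x" by (simp only: matrix_vector_mul_assoc)
    moreover have "inj ((*v) A)"
      using assms inj_matrix_vector_mult invertible_det_nz by blast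
    ultimately have y: "transpose A *v y = x" by (simp only: inj_eq)
    have "(A *v x) \<bullet> y = x \<bullet> (transpose A *v y)"
      by (metis dot_lmul_matrix inner_commute transpose_matrix_vector)
    then show ?thesis by (simp only: y flip: y_def)
  qed
  have dens: "\<bar>det A\<bar> * mvnormal_density ?S (A *v x) = mvnormal_density (mat 1) x" for x
    using assms by (simp add: mvnormal_density_def quad det real_sqrt_mult)
  fix X assume "X \<in> sets (mvnormal ?S)"
  then have X [measurable]: "X \<in> sets borel" by simp
  have "emeasure (mvnormal ?S) X = (\<integral>\<^sup>+v. ennreal (mvnormal_density ?S v) * indicator X v \<partial>lborel)"
    by (simp add: mvnormal_def emeasure_density)
  also have "\<dots> = \<bar>det A\<bar> * (\<integral>\<^sup>+x. ennreal (mvnormal_density ?S (A *v x)) * indicator X (A *v x) \<partial>lborel)"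
    using assms by (intro nn_integral_lborel_linear[symmetric]) simp_all
  also have "\<dots> = (\<integral>\<^sup>+x. ennreal \<bar>det A\<bar> * (ennreal (mvnormal_density ?S (A *v x)) * indicator X (A *v x)) \<partial>lborel)"
    by (intro nn_integral_cmult[symmetric]) measurable
  also have "\<dots> = (\<integral>\<^sup>+x. ennreal (mvnormal_density (mat 1) x) * indicator ((*v) A -` X) x \<partial>lborel)"
    by (simp add: dens[symmetric] ennreal_mult mvnormal_density_nonneg det mult.assoc indicator_def)
  also have "\<dots> = emeasure (mvnormal (mat 1)) ((*v) A -` X)"
    unfolding mvnormal_def
    using measurable_sets[OF measurable_matrix_vector_mult[of A] X]
    by (subst emeasure_density) simp_all
  also have "\<dots> = emeasure (distr (mvnormal (mat 1)) borel ((*v) A)) X"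
    by (subst emeasure_distr) simp_all
  finally show "emeasure (mvnormal ?S) X = emeasure (distr (mvnormal (mat 1)) borel ((*v) A)) X" .
qed simp

lemma distr_density_lborel_uminus:
  fixes g :: "'a :: euclidean_space \<Rightarrow> ennreal"
  assumes [measurable]: "g \<in> borel_measurable borel" and even: "\<And>x. g (- x) = g x"
  shows "distr (density lborel g) borel uminus = density lborel g"
proof -
  have "lborel = distr lborel (borel :: 'a measure) uminus"
    using lborel_affine[of "-1" "0 :: 'a"] by (simp add: density_1)
  then have "density lborel g = density (distr lborel borel uminus) g" by simp
  also have "\<dots> = distr (density lborel g) borel uminus"
    by (subst density_distr) (simp_all add: even)
  finally show ?thesis ..
qed

lemma mvnormal_density_even: "mvnormal_density S (- v) = mvnormal_density S v"
  by (simp add: mvnormal_density_def linear_neg[OF matrix_vector_mul_linear])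

text \<open>The set where \<open>p\<close> is nonzero is open by continuity and null because the
  density is positive everywhere; a nonempty open set is never null.\<close>

lemma continuous_AE_density_imp_all:
  fixes p :: "'a :: euclidean_space \<Rightarrow> real" and g :: "'a \<Rightarrow> real"
  assumes [measurable]: "g \<in> borel_measurable borel" and pos: "\<And>x. 0 < g x"
    and cont: "continuous_on UNIV p" and AE: "AE x in density lborel (\<lambda>x. ennreal (g x)). p x = 0"
  shows "p x = 0"
proof (rule ccontr)
  assume "p x \<noteq> 0"
  have "AE x in lborel. p x = 0"
    using AE pos by (subst (asm) AE_density) auto
  then have "{x. p x \<noteq> 0} \<in> null_sets lborel"
    using cont by (subst (asm) AE_iff_null) (auto intro!: borel_open open_Collect_neq continuous_on_const)
  then have "negligible {x. p x \<noteq> 0}"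
    using negligible_iff_null_sets null_sets_completionI by blast
  moreover have "open {x. p x \<noteq> 0}"
    using cont by (intro open_Collect_neq continuous_on_const)
  ultimately show False using \<open>p x \<noteq> 0\<close> open_not_negligible by blast
qed

text \<open>Later arguments use the noise only through these facts, so the degenerate case \<sigma>
  = 0 is settled here once.\<close>

lemma noise_law:
  assumes "0 \<le> \<sigma>"
  shows prob_space_noise: "prob_space (noise \<sigma>)"
    and sets_noise: "sets (noise \<sigma>) = sets borel"
    and all_moments_noise: "all_moments (noise \<sigma>) (\<lambda>t. t)"
    and noise_mean: "(\<integral>t. t \<partial>noise \<sigma>) = 0"
    and noise_variance: "(\<integral>t. t\<^sup>2 \<partial>noise \<sigma>) = \<sigma>\<^sup>2"
    and distr_noise_uminus: "distr (noise \<sigma>) borel uminus = noise \<sigma>"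
proof -
  show "sets (noise \<sigma>) = sets borel" by (simp add: noise_def)
  show "prob_space (noise \<sigma>)"
    using assms by (auto simp: noise_def prob_space_return intro!: prob_space_normal_density)
  show "all_moments (noise \<sigma>) (\<lambda>t. t)"
  proof (cases "\<sigma> = 0")
    case True
    then show ?thesis
      by (simp add: noise_def all_moments_def integrable_iff_bounded nn_integral_return)
  next
    case False
    then have "0 < \<sigma>" using assms by simp
    then show ?thesis
      using integrable_normal_moment_abs[of \<sigma> 0] False
      by (simp add: noise_def all_moments_def integrable_density)
  qed
  show "(\<integral>t. t \<partial>noise \<sigma>) = 0" "(\<integral>t. t\<^sup>2 \<partial>noise \<sigma>) = \<sigma>\<^sup>2"
    using assms integral_normal_moment_even[of \<sigma> 0 1] integral_normal_moment_odd[of \<sigma> 0 0]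
    by (auto simp: noise_def integral_return integral_density)
  show "distr (noise \<sigma>) borel uminus = noise \<sigma>"
  proof (cases "\<sigma> = 0")
    case True
    then show ?thesis by (simp add: noise_def distr_return)
  next
    case False
    then show ?thesis
      by (simp add: noise_def) (intro distr_density_lborel_uminus, simp_all add: normal_density_def)
  qed
qed

section \<open>Task laws\<close>

text \<open>Common interface of the training mixture and the Gaussian test law. Symmetry under
  negation is what allows the data law to be reflected.\<close>

locale task_law = prob_space \<mu> for \<mu> :: "(real ^ 'd) measure" +
  fixes S :: "real ^ 'd ^ 'd"
  assumes sets_task [simp, measurable_cong]: "sets \<mu> = sets borel"
    and distr_task_uminus: "distr \<mu> borel uminus = \<mu>"
    and task_moments: "all_moments \<mu> (\<lambda>w. w $ a)"
    and task_second_moment: "(\<integral>w. w $ a * w $ b \<partial>\<mu>) = S $ a $ b"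

lemma task_law_mvnormal_linear:
  fixes A :: "real ^ 'd ^ 'd"
  assumes "det A \<noteq> 0"
  shows "task_law (mvnormal (A ** transpose A)) (A ** transpose A)"
proof -
  interpret N: prob_space "mvnormal (mat 1 :: real ^ 'd ^ 'd)" by (rule prob_space_mvnormal_mat_1)
  have eq: "mvnormal (A ** transpose A) = distr (mvnormal (mat 1)) borel ((*v) A)"
    using assms by (rule mvnormal_linear_image)
  have nth: "(A *v v) $ a = (\<Sum>c\<in>UNIV. A $ a $ c * v $ c)" for v a
    by (simp add: matrix_vector_mult_def)
  have mom: "all_moments (mvnormal (mat 1)) (\<lambda>v. (A *v v) $ a)" for a
    unfolding nth
    by (intro N.all_moments_sum all_moments_mult N.all_moments_const all_moments_mvnormal_mat_1)
  have int: "integrable (mvnormal (mat 1 :: real ^ 'd ^ 'd)) (\<lambda>v. v $ c * v $ e)" for c e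
    by (intro all_moments_integrable all_moments_mult all_moments_mvnormal_mat_1)
  show ?thesis
  proof (intro task_law.intro task_law_axioms.intro)
    show "prob_space (mvnormal (A ** transpose A))"
      unfolding eq by (intro N.prob_space_distr) simp
    show "distr (mvnormal (A ** transpose A)) borel uminus = mvnormal (A ** transpose A)"
      unfolding mvnormal_def by (intro distr_density_lborel_uminus) (simp_all add: mvnormal_density_even)
    show "all_moments (mvnormal (A ** transpose A)) (\<lambda>w. w $ a)" for a
      unfolding eq by (subst all_moments_distr) (simp_all add: mom)
    fix a b
    have "(\<integral>w. w $ a * w $ b \<partial>mvnormal (A ** transpose A))
        = (\<integral>v. (A *v v) $ a * (A *v v) $ b \<partial>mvnormal (mat 1))"
      unfolding eq by (subst integral_distr) simp_all
    also have "\<dots> = (\<integral>v. (\<Sum>c\<in>UNIV. \<Sum>e\<in>UNIV. A $ a $ c * A $ b $ e * (v $ c * v $ e)) \<partial>mvnormal (mat 1))"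
      unfolding nth sum_product by (simp add: mult_ac)
    also have "\<dots> = (\<Sum>c\<in>UNIV. \<Sum>e\<in>UNIV. A $ a $ c * A $ b $ e * of_bool (c = e))"
      using int by (simp add: Bochner_Integration.integral_sum mvnormal_mat_1_moment_2)
    also have "\<dots> = (\<Sum>c\<in>UNIV. A $ a $ c * A $ b $ c)"
      by (simp add: of_bool_def if_distrib cong: if_cong)
    finally show "(\<integral>w. w $ a * w $ b \<partial>mvnormal (A ** transpose A)) = (A ** transpose A) $ a $ b"
      by (simp add: matrix_matrix_mult_def transpose_def)
  qed simp
qed

text \<open>Viewed as a bounded bilinear map, matrix multiplication gets its rules for sums and
  scalars together with its limit rules.\<close>

interpretation matrix_mult: bounded_bilinear
  "(**) :: real ^ 'n ^ 'm \<Rightarrow> real ^ 'p ^ 'n \<Rightarrow> real ^ 'p ^ 'm"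
  by (rule bilinear_conv_bounded_bilinear[THEN iffD1])
    (auto simp: bilinear_def linear_iff vec_eq_iff matrix_matrix_mult_def sum.distrib
      sum_distrib_left algebra_simps)

lemma task_cov_square:
  fixes U :: "real ^ 'r ^ 'd"
  assumes U: "transpose U ** U = mat 1" and "0 < \<epsilon>"
  shows "\<exists>A :: real ^ 'd ^ 'd. det A \<noteq> 0 \<and> A ** transpose A = task_cov U \<epsilon>"
proof -
  define P where "P = U ** transpose U"
  have PP: "P ** P = P"
    unfolding P_def by (metis U matrix_mul_assoc matrix_mul_rid)
  have PT: "transpose P = P"
    by (simp add: P_def matrix_transpose_mul)
  have mult: "(a *\<^sub>R mat 1 + b *\<^sub>R P) ** (a' *\<^sub>R mat 1 + b' *\<^sub>R P)
      = (a * a') *\<^sub>R mat 1 + (a * b' + b * a' + b * b') *\<^sub>R P" for a b a' b' :: real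
    by (simp add: matrix_mult.add_left matrix_mult.add_right matrix_mult.scaleR_left
        matrix_mult.scaleR_right PP algebra_simps)
  \<comment> \<open>\<open>P\<close> is an orthogonal projection, so
    \<open>task_cov U \<epsilon>\<close> has eigenvalue 1 + \<epsilon> on its range and \<epsilon>
    on the complement. \<open>?A\<close> has the square roots of these as eigenvalues, and its
    inverse below has the reciprocals of the roots.\<close>
  define s t where "s = sqrt \<epsilon>" and "t = sqrt (1 + \<epsilon>)"
  have st: "s \<noteq> 0" "t \<noteq> 0" "s * s = \<epsilon>" "t * t = 1 + \<epsilon>" using \<open>0 < \<epsilon>\<close> by (auto simp: s_def t_def)
  let ?A = "s *\<^sub>R mat 1 + (t - s) *\<^sub>R P"
  have "?A ** ((1 / s) *\<^sub>R mat 1 + (1 / t - 1 / s) *\<^sub>R P) = mat 1"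
    unfolding mult using st by (simp add: field_simps)
  then have "det ?A \<noteq> 0"
    by (metis det_I det_mul mult_zero_left zero_neq_one)
  moreover have "transpose ?A = ?A"
    using PT by (simp add: transpose_def vec_eq_iff mat_def)
  moreover have "?A ** ?A = task_cov U \<epsilon>"
  proof -
    have "s * (t - s) + (t - s) * s + (t - s) * (t - s) = t * t - s * s" by (simp add: algebra_simps)
    then show ?thesis unfolding mult by (simp add: st task_cov_def P_def)
  qed
  ultimately show ?thesis by metis
qed

lemma task_law_task_cov:
  fixes U :: "real ^ 'r ^ 'd"
  assumes "transpose U ** U = mat 1" and "0 < \<epsilon>"
  shows "task_law (mvnormal (task_cov U \<epsilon>)) (task_cov U \<epsilon>)" and "0 < det (task_cov U \<epsilon>)"
proof -
  obtain A :: "real ^ 'd ^ 'd" where A: "det A \<noteq> 0" "A ** transpose A = task_cov U \<epsilon>"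
    using task_cov_square[OF assms] by auto
  then show "task_law (mvnormal (task_cov U \<epsilon>)) (task_cov U \<epsilon>)"
    using task_law_mvnormal_linear[of A] by simp
  have "det (task_cov U \<epsilon>) = (det A)\<^sup>2"
    unfolding A(2)[symmetric] by (simp add: det_mul power2_eq_square)
  then show "0 < det (task_cov U \<epsilon>)" using A(1) by simp
qed

lemma task_law_mixture:
  fixes S :: "nat \<Rightarrow> real ^ 'd ^ 'd"
  assumes "1 \<le> K" and law: "\<And>k. k \<in> {1..K} \<Longrightarrow> task_law (mvnormal (S k)) (S k)"
    and det: "\<And>k. k \<in> {1..K} \<Longrightarrow> 0 < det (S k)"
  shows "task_law (density lborel (\<lambda>v. ennreal (\<Sum>k=1..K. 1 / real K * mvnormal_density (S k) v)))
    ((1 / real K) *\<^sub>R (\<Sum>k=1..K. S k))"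
proof -
  define g where "g v = (\<Sum>k=1..K. 1 / real K * mvnormal_density (S k) v)" for v
  have [measurable]: "g \<in> borel_measurable borel" unfolding g_def by measurable
  have g0: "0 \<le> g v" for v
    unfolding g_def using det by (intro sum_nonneg mult_nonneg_nonneg mvnormal_density_nonneg) (auto intro: less_imp_le)
  \<comment> \<open>Integrals against the mixture are averages over the components; total mass,
    moments and covariance then follow by choosing \<open>f\<close>.\<close>
  have int: "integrable (density lborel (\<lambda>v. ennreal (g v))) f"
    and val: "(\<integral>v. f v \<partial>density lborel (\<lambda>v. ennreal (g v)))
      = (\<Sum>k=1..K. 1 / real K * (\<integral>v. f v \<partial>mvnormal (S k)))"
    if f [measurable]: "f \<in> borel_measurable borel"
      and fk: "\<And>k. k \<in> {1..K} \<Longrightarrow> integrable (mvnormal (S k)) f" for f :: "real ^ 'd \<Rightarrow> real"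
  proof -
    have fk': "integrable lborel (\<lambda>v. mvnormal_density (S k) v * f v)" if "k \<in> {1..K}" for k
      using fk[OF that] det[OF that] by (subst (asm) integrable_mvnormal_iff) auto
    have eq: "g v * f v = (\<Sum>k=1..K. 1 / real K * (mvnormal_density (S k) v * f v))" for v
      by (simp add: g_def sum_distrib_right mult.assoc)
    have "integrable lborel (\<lambda>v. g v * f v)"
      unfolding eq by (intro Bochner_Integration.integrable_sum integrable_mult_right fk')
    then show "integrable (density lborel (\<lambda>v. ennreal (g v))) f"
      by (subst integrable_density) (simp_all add: g0)
    have "(\<integral>v. f v \<partial>density lborel (\<lambda>v. ennreal (g v))) = (\<integral>v. g v * f v \<partial>lborel)"
      by (subst integral_density) (simp_all add: g0)
    also have "\<dots> = (\<Sum>k=1..K. 1 / real K * (\<integral>v. mvnormal_density (S k) v * f v \<partial>lborel))"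
      unfolding eq using fk'
      by (subst Bochner_Integration.integral_sum) auto
    also have "\<dots> = (\<Sum>k=1..K. 1 / real K * (\<integral>v. f v \<partial>mvnormal (S k)))"
      using det by (intro sum.cong refl) (subst integral_mvnormal, auto intro: less_imp_le)
    finally show "(\<integral>v. f v \<partial>density lborel (\<lambda>v. ennreal (g v)))
      = (\<Sum>k=1..K. 1 / real K * (\<integral>v. f v \<partial>mvnormal (S k)))" .
  qed
  have one: "(\<integral>v. 1 \<partial>mvnormal (S k)) = (1 :: real)" "integrable (mvnormal (S k)) (\<lambda>_. 1 :: real)" if "k \<in> {1..K}" for k
  proof -
    interpret task_law "mvnormal (S k)" "S k" by (rule law[OF that])
    show "(\<integral>v. 1 \<partial>mvnormal (S k)) = (1 :: real)" "integrable (mvnormal (S k)) (\<lambda>_. 1 :: real)"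
      using prob_space by simp_all
  qed
  have "task_law (density lborel (\<lambda>v. ennreal (g v))) ((1 / real K) *\<^sub>R (\<Sum>k=1..K. S k))"
  proof (intro task_law.intro task_law_axioms.intro)
    show "prob_space (density lborel (\<lambda>v. ennreal (g v)))"
    proof
      have "integrable (density lborel (\<lambda>v. ennreal (g v))) (\<lambda>_. 1 :: real)"
        by (rule int) (simp_all add: one)
      then have "integrable lborel g"
        by (subst (asm) integrable_density) (simp_all add: g0)
      moreover have "(\<integral>v. g v \<partial>lborel) = 1"
      proof -
        have "(\<integral>v. 1 \<partial>density lborel (\<lambda>v. ennreal (g v)))
            = (\<Sum>k=1..K. 1 / real K * (\<integral>v. 1 \<partial>mvnormal (S k)))"
          by (rule val) (simp_all add: one)
        also have "\<dots> = (\<Sum>k=1..K. 1 / real K)"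
          by (rule sum.cong[OF refl]) (simp only: one mult_1_right)
        finally have "(\<integral>v. 1 \<partial>density lborel (\<lambda>v. ennreal (g v))) = (1 :: real)"
          using \<open>1 \<le> K\<close> by simp
        then show ?thesis
          by (subst (asm) integral_density) (simp_all add: g0)
      qed
      ultimately have "(\<integral>\<^sup>+v. g v \<partial>lborel) = 1"
        using g0 by (subst nn_integral_eq_integral) simp_all
      then show "emeasure (density lborel (\<lambda>v. ennreal (g v)))
          (space (density lborel (\<lambda>v. ennreal (g v)))) = 1"
        by (simp add: emeasure_density)
    qed
    show "distr (density lborel (\<lambda>v. ennreal (g v))) borel uminus = density lborel (\<lambda>v. ennreal (g v))"
      by (intro distr_density_lborel_uminus) (simp_all add: g_def mvnormal_density_even)
    show "all_moments (density lborel (\<lambda>v. ennreal (g v))) (\<lambda>w. w $ a)" for a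
      unfolding all_moments_def
      by (intro conjI allI int all_moments_integrable_abs task_law.task_moments[OF law]) simp_all
    fix a b
    have "integrable (mvnormal (S k)) (\<lambda>w. w $ a * w $ b)" if "k \<in> {1..K}" for k
      by (intro all_moments_integrable all_moments_mult task_law.task_moments[OF law[OF that]])
    then have "(\<integral>w. w $ a * w $ b \<partial>density lborel (\<lambda>v. ennreal (g v)))
        = (\<Sum>k=1..K. 1 / real K * S k $ a $ b)"
      using law by (subst val) (auto intro!: sum.cong simp: task_law.task_second_moment)
    also have "\<dots> = ((1 / real K) *\<^sub>R (\<Sum>k=1..K. S k)) $ a $ b"
      by (simp add: sum_divide_distrib)
    finally show "(\<integral>w. w $ a * w $ b \<partial>density lborel (\<lambda>v. ennreal (g v)))
        = ((1 / real K) *\<^sub>R (\<Sum>k=1..K. S k)) $ a $ b" .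
  qed simp
  then show ?thesis by (simp only: g_def)
qed

section \<open>Moments of the data\<close>

type_synonym 'd sample = "(nat \<Rightarrow> real ^ 'd) \<times> (real ^ 'd) \<times> (nat \<Rightarrow> real)"

definition feat :: "nat \<Rightarrow> 'd::finite \<Rightarrow> 'd sample \<Rightarrow> real" where
  "feat i a z = fst z i $ a"

definition task :: "'d::finite \<Rightarrow> 'd sample \<Rightarrow> real" where
  "task a z = fst (snd z) $ a"

definition err :: "nat \<Rightarrow> 'd::finite sample \<Rightarrow> real" where
  "err i z = snd (snd z) i"

definition resp :: "nat \<Rightarrow> 'd::finite sample \<Rightarrow> real" where
  "resp i z = (\<Sum>c\<in>UNIV. task c z * feat i c z) + err i z"

text \<open>
  A function that ignores the \<open>i\<close>-th example is independent of that example, so moments of the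
  \<open>i\<close>-th example factor out of its integrals.
\<close>

definition free_of :: "nat \<Rightarrow> ('d::finite sample \<Rightarrow> real) \<Rightarrow> bool" where
  "free_of i f \<longleftrightarrow> (\<forall>x w \<xi> s t. f (x(i := s), w, \<xi>(i := t)) = f (x, w, \<xi>))"

lemma free_of_const: "free_of i (\<lambda>z. c)"
  and free_of_task: "free_of i (\<lambda>z. task a z)"
  and free_of_feat: "i \<noteq> j \<Longrightarrow> free_of i (\<lambda>z. feat j a z)"
  and free_of_err: "i \<noteq> j \<Longrightarrow> free_of i (\<lambda>z. err j z)"
  and free_of_resp: "i \<noteq> j \<Longrightarrow> free_of i (\<lambda>z. resp j z)"
  by (simp_all add: free_of_def task_def feat_def err_def resp_def)

lemma free_of_mult: "free_of i f \<Longrightarrow> free_of i g \<Longrightarrow> free_of i (\<lambda>z. f z * g z)"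
  and free_of_add: "free_of i f \<Longrightarrow> free_of i g \<Longrightarrow> free_of i (\<lambda>z. f z + g z)"
  and free_of_diff: "free_of i f \<Longrightarrow> free_of i g \<Longrightarrow> free_of i (\<lambda>z. f z - g z)"
  and free_of_power: "free_of i f \<Longrightarrow> free_of i (\<lambda>z. f z ^ k)"
  by (simp_all add: free_of_def)

lemma free_of_sum: "(\<And>j. j \<in> J \<Longrightarrow> free_of i (f j)) \<Longrightarrow> free_of i (\<lambda>z. \<Sum>j\<in>J. f j z)"
  by (auto simp: free_of_def intro!: sum.cong)

lemmas free_of_intros = free_of_const free_of_task free_of_feat free_of_err free_of_resp
  free_of_mult free_of_add free_of_diff free_of_power free_of_sum

lemma sum_of_bool_pair:
  fixes f :: "'a :: finite \<Rightarrow> 'b :: finite \<Rightarrow> real"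
  shows "(\<Sum>c\<in>UNIV. \<Sum>e\<in>UNIV. of_bool (c = x \<and> e = y) * f c e) = f x y"
proof -
  have "(\<Sum>e\<in>UNIV. of_bool (c = x \<and> e = y) * f c e) = (if c = x then f c y else 0)" for c
    by (simp add: of_bool_def if_distrib[of "\<lambda>x. x * _"] cong: if_cong)
  then show ?thesis by simp
qed

locale regression_data = task_law \<mu> S for \<mu> :: "(real ^ 'd) measure" and S +
  fixes \<sigma> :: real and n :: nat
  assumes sigma_nonneg: "0 \<le> \<sigma>" and n_pos: "1 \<le> n"
begin

abbreviation M :: "'d sample measure" where "M \<equiv> data_law \<sigma> \<mu> n"

lemma prob_space_feats: "prob_space (\<Pi>\<^sub>M i\<in>{1..n+1}. mvnormal (mat 1 :: real ^ 'd ^ 'd))"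
  by (intro prob_space_PiM prob_space_mvnormal_mat_1)

lemma prob_space_noises: "prob_space (\<Pi>\<^sub>M i\<in>{1..n+1}. noise \<sigma>)"
  by (intro prob_space_PiM prob_space_noise sigma_nonneg)

lemma prob_space_task_noises: "prob_space (\<mu> \<Otimes>\<^sub>M (\<Pi>\<^sub>M i\<in>{1..n+1}. noise \<sigma>))"
  by (intro prob_space_pair prob_space_axioms prob_space_noises)

sublocale M: prob_space M
  unfolding data_law_def
  by (intro prob_space_pair prob_space_feats prob_space_task_noises)

lemma moments_feat: "i \<in> {1..n+1} \<Longrightarrow> all_moments M (\<lambda>z. feat i a z)"
  unfolding data_law_def feat_def
  by (intro all_moments_fst[where f = "\<lambda>x. x i $ a"] prob_space_task_noises
      all_moments_PiM_component[where f = "\<lambda>v. v $ a"] prob_space_mvnormal_mat_1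
      all_moments_mvnormal_mat_1) simp_all

lemma moments_task: "all_moments M (\<lambda>z. task a z)"
  unfolding data_law_def task_def
  by (intro all_moments_snd[where f = "\<lambda>z. fst z $ a"] prob_space_feats prob_space_noises
      prob_space_imp_sigma_finite prob_space_task_noises
      all_moments_fst[where f = "\<lambda>w. w $ a"] task_moments)

lemma moments_err: "i \<in> {1..n+1} \<Longrightarrow> all_moments M (\<lambda>z. err i z)"
  unfolding data_law_def err_def
  by (intro all_moments_snd[where f = "\<lambda>z. snd z i"] prob_space_feats prob_space_noises
      prob_space_imp_sigma_finite prob_space_task_noises prob_space_axioms
      all_moments_snd[where f = "\<lambda>\<xi>. \<xi> i"]
      all_moments_PiM_component[where f = "\<lambda>t. t"] prob_space_noise all_moments_noise sigma_nonneg) simp_all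

lemma moments_resp: "i \<in> {1..n+1} \<Longrightarrow> all_moments M (\<lambda>z. resp i z)"
  unfolding resp_def
  by (intro all_moments_add M.all_moments_sum all_moments_mult moments_feat moments_task moments_err)

lemmas moments_intros = moments_feat moments_task moments_err moments_resp M.all_moments_const
  all_moments_mult all_moments_add M.all_moments_diff M.all_moments_power M.all_moments_sum

lemmas integrable_intros = all_moments_integrable moments_intros

lemma integral_fresh:
  assumes "i \<in> {1..n+1}" "all_moments (mvnormal (mat 1)) g1" "all_moments (noise \<sigma>) g2"
    and "all_moments M f" "free_of i f"
  shows "(\<integral>z. g1 (fst z i) * g2 (err i z) * f z \<partial>M)
      = (\<integral>v. g1 v \<partial>mvnormal (mat 1)) * (\<integral>t. g2 t \<partial>noise \<sigma>) * (\<integral>z. f z \<partial>M)"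
  using integral_product_factor[of "{1..n+1}" i "{1..n+1}" i "\<lambda>_. mvnormal (mat 1)" "\<lambda>_. noise \<sigma>"
      \<mu> g1 g2 f] assms
  by (simp add: data_law_def free_of_def err_def prob_space_mvnormal_mat_1
      prob_space_noise[OF sigma_nonneg] prob_space_axioms split_def)

lemma moments_noise_power: "all_moments (noise \<sigma>) (\<lambda>t. t ^ k)"
proof -
  interpret N: prob_space "noise \<sigma>" by (rule prob_space_noise[OF sigma_nonneg])
  show ?thesis by (intro N.all_moments_power all_moments_noise sigma_nonneg)
qed

lemma integral_fresh_feat_2:
  assumes "i \<in> {1..n+1}" "all_moments M f" "free_of i f"
  shows "(\<integral>z. feat i a z * feat i b z * f z \<partial>M) = of_bool (a = b) * (\<integral>z. f z \<partial>M)"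
    and "(\<integral>z. feat i a z * feat i b z * (err i z)\<^sup>2 * f z \<partial>M) = of_bool (a = b) * \<sigma>\<^sup>2 * (\<integral>z. f z \<partial>M)"
  \<comment> \<open>The zeroth noise power is the constant 1, which removes the noise factor from
    the first identity.\<close>
  using integral_fresh[OF assms(1) _ moments_noise_power[of 0] assms(2,3), of "\<lambda>v. v $ a * v $ b"]
    integral_fresh[OF assms(1) _ moments_noise_power[of 2] assms(2,3), of "\<lambda>v. v $ a * v $ b"]
  by (simp_all add: feat_def all_moments_mult all_moments_mvnormal_mat_1 mvnormal_mat_1_moment_2
      noise_variance[OF sigma_nonneg] prob_space.prob_space[OF prob_space_noise[OF sigma_nonneg]])

lemma integral_fresh_feat_4:
  assumes "i \<in> {1..n+1}" "all_moments M f" "free_of i f"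
  shows "(\<integral>z. feat i a z * feat i b z * feat i c z * feat i e z * f z \<partial>M)
    = (of_bool (a = b \<and> c = e) + of_bool (a = c \<and> b = e) + of_bool (a = e \<and> b = c)) * (\<integral>z. f z \<partial>M)"
  using integral_fresh[OF assms(1) _ moments_noise_power[of 0] assms(2,3),
      of "\<lambda>v. v $ a * v $ b * v $ c * v $ e"]
  by (simp add: feat_def all_moments_mult all_moments_mvnormal_mat_1 mvnormal_mat_1_moment_4
      prob_space.prob_space[OF prob_space_noise[OF sigma_nonneg]])

lemma integral_fresh_noise:
  assumes "i \<in> {1..n+1}" "all_moments M f" "free_of i f"
  shows "(\<integral>z. feat i a z * err i z * f z \<partial>M) = 0"
    and "(\<integral>z. feat i a z * feat i b z * feat i c z * err i z * f z \<partial>M) = 0"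
    and "(\<integral>z. (err i z)\<^sup>2 * f z \<partial>M) = \<sigma>\<^sup>2 * (\<integral>z. f z \<partial>M)"
proof -
  interpret N: prob_space "mvnormal (mat 1 :: real ^ 'd ^ 'd)" by (rule prob_space_mvnormal_mat_1)
  show "(\<integral>z. feat i a z * err i z * f z \<partial>M) = 0"
    "(\<integral>z. feat i a z * feat i b z * feat i c z * err i z * f z \<partial>M) = 0"
    "(\<integral>z. (err i z)\<^sup>2 * f z \<partial>M) = \<sigma>\<^sup>2 * (\<integral>z. f z \<partial>M)"
    using integral_fresh[OF assms(1) _ moments_noise_power[of 1] assms(2,3), of "\<lambda>v. v $ a"]
      integral_fresh[OF assms(1) _ moments_noise_power[of 1] assms(2,3), of "\<lambda>v. v $ a * v $ b * v $ c"]
      integral_fresh[OF assms(1) N.all_moments_const moments_noise_power[of 2] assms(2,3), of 1]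
      N.prob_space
    by (simp_all add: feat_def all_moments_mult all_moments_mvnormal_mat_1 noise_mean[OF sigma_nonneg]
        noise_variance[OF sigma_nonneg])
qed

lemma integral_task:
  fixes f :: "real ^ 'd \<Rightarrow> real"
  assumes [measurable]: "f \<in> borel_measurable borel"
  shows "(\<integral>z. f (fst (snd z)) \<partial>M) = (\<integral>w. f w \<partial>\<mu>)"
proof -
  have "distr (\<mu> \<Otimes>\<^sub>M (\<Pi>\<^sub>M i\<in>{1..n+1}. noise \<sigma>)) \<mu> fst = \<mu>"
    by (intro prob_space.distr_pair_fst prob_space_noises)
  moreover have "distr M (\<mu> \<Otimes>\<^sub>M (\<Pi>\<^sub>M i\<in>{1..n+1}. noise \<sigma>)) snd = \<mu> \<Otimes>\<^sub>M (\<Pi>\<^sub>M i\<in>{1..n+1}. noise \<sigma>)"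
    unfolding data_law_def
    by (intro distr_pair_snd prob_space_feats prob_space_imp_sigma_finite prob_space_task_noises)
  moreover have snd_m: "snd \<in> measurable M (\<mu> \<Otimes>\<^sub>M (\<Pi>\<^sub>M i\<in>{1..n+1}. noise \<sigma>))"
    unfolding data_law_def by measurable
  ultimately have "\<mu> = distr M \<mu> (\<lambda>z. fst (snd z))"
    using distr_distr[OF measurable_fst snd_m] by (simp add: o_def)
  then have "(\<integral>w. f w \<partial>\<mu>) = (\<integral>w. f w \<partial>distr M \<mu> (\<lambda>z. fst (snd z)))" by simp
  also have "\<dots> = (\<integral>z. f (fst (snd z)) \<partial>M)"
    by (rule integral_distr[OF measurable_compose[OF snd_m measurable_fst]]) measurable
  finally show ?thesis ..
qed

lemma integral_task_2: "(\<integral>z. task a z * task b z \<partial>M) = S $ a $ b"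
  using integral_task[of "\<lambda>w. w $ a * w $ b"] by (simp add: task_def task_second_moment)

text \<open>Given the task, the features have identity covariance and the noise has mean zero, so
  y_i x_i is an unbiased estimate of the task vector.\<close>

lemma integral_resp_feat:
  assumes "i \<in> {1..n+1}" "all_moments M f" "free_of i f"
  shows "(\<integral>z. resp i z * feat i a z * f z \<partial>M) = (\<integral>z. task a z * f z \<partial>M)"
proof -
  have "(\<integral>z. resp i z * feat i a z * f z \<partial>M)
      = (\<integral>z. (\<Sum>c\<in>UNIV. feat i c z * feat i a z * (task c z * f z)) + feat i a z * err i z * f z \<partial>M)"
    by (simp add: resp_def sum_distrib_left sum_distrib_right algebra_simps)
  also have "\<dots> = (\<Sum>c\<in>UNIV. (\<integral>z. feat i c z * feat i a z * (task c z * f z) \<partial>M))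
      + (\<integral>z. feat i a z * err i z * f z \<partial>M)"
    using assms
    by (simp add: integrable_intros)
  also have "\<dots> = (\<Sum>c\<in>UNIV. of_bool (c = a) * (\<integral>z. task c z * f z \<partial>M))"
    using assms by (simp add: integral_fresh_feat_2 integral_fresh_noise moments_intros free_of_intros)
  also have "\<dots> = (\<integral>z. task a z * f z \<partial>M)"
    by (simp add: of_bool_def if_distrib[of "\<lambda>x. x * _"] cong: if_cong)
  finally show ?thesis .
qed

text \<open>The conditional second moment of a label given the task is |w|^2 + \<sigma>^2; the mixed
  terms die with the noise mean.\<close>

lemma integral_resp_sq:
  assumes "i \<in> {1..n+1}" "all_moments M f" "free_of i f"
  shows "(\<integral>z. (resp i z)\<^sup>2 * f z \<partial>M) = (\<integral>z. ((\<Sum>c\<in>UNIV. (task c z)\<^sup>2) + \<sigma>\<^sup>2) * f z \<partial>M)"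
proof -
  have "(\<integral>z. (resp i z)\<^sup>2 * f z \<partial>M)
      = (\<integral>z. (\<Sum>c\<in>UNIV. \<Sum>e\<in>UNIV. feat i c z * feat i e z * (task c z * task e z * f z))
          + (\<Sum>c\<in>UNIV. 2 * (feat i c z * err i z * (task c z * f z))) + (err i z)\<^sup>2 * f z \<partial>M)"
    by (simp add: resp_def power2_eq_square sum_product sum_distrib_left sum_distrib_right sum.distrib algebra_simps)
  also have "\<dots> = (\<Sum>c\<in>UNIV. \<Sum>e\<in>UNIV. (\<integral>z. feat i c z * feat i e z * (task c z * task e z * f z) \<partial>M))
      + (\<Sum>c\<in>UNIV. 2 * (\<integral>z. feat i c z * err i z * (task c z * f z) \<partial>M)) + (\<integral>z. (err i z)\<^sup>2 * f z \<partial>M)"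
    using assms by (simp add: integrable_intros)
  also have "\<dots> = (\<Sum>c\<in>UNIV. \<Sum>e\<in>UNIV. of_bool (c = e) * (\<integral>z. task c z * task e z * f z \<partial>M)) + \<sigma>\<^sup>2 * (\<integral>z. f z \<partial>M)"
    using assms by (simp add: integral_fresh_feat_2 integral_fresh_noise moments_intros free_of_intros)
  also have "\<dots> = (\<Sum>c\<in>UNIV. (\<integral>z. task c z * task c z * f z \<partial>M)) + \<sigma>\<^sup>2 * (\<integral>z. f z \<partial>M)"
    by (simp add: of_bool_def if_distrib[of "\<lambda>x. x * _"] cong: if_cong)
  also have "\<dots> = (\<integral>z. (\<Sum>c\<in>UNIV. task c z * task c z * f z) + \<sigma>\<^sup>2 * f z \<partial>M)"
    using assms by (simp add: integrable_intros)
  also have "\<dots> = (\<integral>z. ((\<Sum>c\<in>UNIV. (task c z)\<^sup>2) + \<sigma>\<^sup>2) * f z \<partial>M)"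
    by (simp add: power2_eq_square sum_distrib_left sum_distrib_right algebra_simps)
  finally show ?thesis .
qed

text \<open>The quadratic task terms meet a fourth moment of the features. The three pairings give
  the trace once and \<open>S\<close> twice, and the squared noise adds \<sigma>^2. This is the
  origin of the 1/n correction in \<open>cov_noisy\<close>.\<close>

lemma integral_resp_sq_feat_2:
  assumes i: "i \<in> {1..n+1}"
  shows "(\<integral>z. (resp i z)\<^sup>2 * (feat i a z * feat i b z) \<partial>M)
    = 2 * S $ a $ b + of_bool (a = b) * (trace S + \<sigma>\<^sup>2)"
proof -
  have "(\<integral>z. (resp i z)\<^sup>2 * (feat i a z * feat i b z) \<partial>M)
      = (\<integral>z. (\<Sum>c\<in>UNIV. \<Sum>e\<in>UNIV. feat i c z * feat i e z * feat i a z * feat i b z * (task c z * task e z))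
          + (\<Sum>c\<in>UNIV. 2 * (feat i c z * feat i a z * feat i b z * err i z * task c z))
          + feat i a z * feat i b z * (err i z)\<^sup>2 * 1 \<partial>M)"
    by (simp add: resp_def power2_eq_square sum_product sum_distrib_left sum_distrib_right sum.distrib algebra_simps)
  also have "\<dots> = (\<Sum>c\<in>UNIV. \<Sum>e\<in>UNIV. (\<integral>z. feat i c z * feat i e z * feat i a z * feat i b z * (task c z * task e z) \<partial>M))
      + (\<Sum>c\<in>UNIV. 2 * (\<integral>z. feat i c z * feat i a z * feat i b z * err i z * task c z \<partial>M))
      + (\<integral>z. feat i a z * feat i b z * (err i z)\<^sup>2 * 1 \<partial>M)"
    using i by (simp add: integrable_intros)
  also have "\<dots> = (\<Sum>c\<in>UNIV. \<Sum>e\<in>UNIV. (of_bool (c = e \<and> a = b) + of_bool (c = a \<and> e = b)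
        + of_bool (c = b \<and> e = a)) * S $ c $ e) + of_bool (a = b) * \<sigma>\<^sup>2"
    unfolding integral_fresh_feat_4[OF i all_moments_mult[OF moments_task moments_task]
        free_of_mult[OF free_of_task free_of_task]]
      integral_fresh_noise(2)[OF i moments_task free_of_task]
      integral_fresh_feat_2(2)[OF i M.all_moments_const free_of_const] integral_task_2
    using M.prob_space by simp
  also have "(\<Sum>c\<in>UNIV. \<Sum>e\<in>UNIV. (of_bool (c = e \<and> a = b) + of_bool (c = a \<and> e = b)
        + of_bool (c = b \<and> e = a)) * S $ c $ e) = of_bool (a = b) * trace S + S $ a $ b + S $ b $ a"
  proof -
    have "(\<Sum>e\<in>UNIV. of_bool (c = e \<and> a = b) * S $ c $ e) = of_bool (a = b) * S $ c $ c" for c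
      by (simp add: of_bool_def if_distrib[of "\<lambda>x. x * _"] cong: if_cong)
    then show ?thesis
      by (simp only: distrib_right sum.distrib sum_of_bool_pair)
        (simp add: trace_def sum_distrib_left)
  qed
  also have "S $ b $ a = S $ a $ b"
    using task_second_moment[of a b] task_second_moment[of b a] by (simp add: mult.commute)
  finally show ?thesis by (simp add: distrib_left)
qed

end

section \<open>The risk of linear attention\<close>

definition attn_odd :: "real ^ 'd ^ 'd \<Rightarrow> nat \<Rightarrow> 'd \<Rightarrow> 'd::finite sample \<Rightarrow> real" where
  "attn_odd C n k z = 1 / real n * (\<Sum>i=1..n. \<Sum>a\<in>UNIV. C $ k $ a * (resp i z * feat i a z))"

definition attn_even ::
  "real ^ 'd ^ 'd \<Rightarrow> real ^ 'd \<Rightarrow> real ^ 'd \<Rightarrow> nat \<Rightarrow> 'd \<Rightarrow> 'd::finite sample \<Rightarrow> real" where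
  "attn_even B u e n k z = 1 / real n *
     (\<Sum>i=1..n. (\<Sum>a\<in>UNIV. \<Sum>b\<in>UNIV. u $ a * B $ k $ b * (feat i a z * feat i b z)) + e $ k * (resp i z)\<^sup>2)"

definition score_mat :: "'d::finite weights \<Rightarrow> real ^ 'd option ^ 'd option" where
  "score_mat W = fst W ** transpose (fst (snd W))"

definition value_vec :: "'d::finite weights \<Rightarrow> real ^ 'd option" where
  "value_vec W = snd (snd W) *v axis None 1"

text \<open>Score times value of one context row is quadratic in its features and its label. Pure
  feature terms give \<open>attn_B\<close> with \<open>attn_u\<close>, the squared label gives
  \<open>attn_e\<close>, and the two mixed terms combine into \<open>attn_C\<close>. The row
  \<open>None\<close> of \<open>score_mat\<close> is absent because the last query coordinate is
  zero.\<close>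

definition attn_B :: "'d::finite weights \<Rightarrow> real ^ 'd ^ 'd" where
  "attn_B W = (\<chi> k a. score_mat W $ Some k $ Some a)"

definition attn_u :: "'d::finite weights \<Rightarrow> real ^ 'd" where
  "attn_u W = (\<chi> a. value_vec W $ Some a)"

definition attn_e :: "'d::finite weights \<Rightarrow> real ^ 'd" where
  "attn_e W = (\<chi> k. value_vec W $ None * score_mat W $ Some k $ None)"

definition attn_C :: "'d::finite weights \<Rightarrow> real ^ 'd ^ 'd" where
  "attn_C W = (\<chi> k a. value_vec W $ None * score_mat W $ Some k $ Some a
     + score_mat W $ Some k $ None * value_vec W $ Some a)"

lemma sum_option: "(\<Sum>j\<in>UNIV. f j) = f None + (\<Sum>a\<in>UNIV. f (Some a))"
  for f :: "'a::finite option \<Rightarrow> 'b::comm_monoid_add"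
  by (simp add: UNIV_option_conv sum.reindex)

lemma label_eq_resp: "label x w \<xi> i = resp i (x, w, \<xi>)"
  by (simp add: label_def resp_def task_def feat_def err_def inner_vec_def)

text \<open>The mask removes the query from the sum over examples, so the sums stop at
  \<open>n\<close> and the query features enter linearly.\<close>

lemma lin_attn_eq:
  "lin_attn W n (prompt n x (label x w \<xi>))
     = (\<Sum>k\<in>UNIV. feat (n + 1) k (x, w, \<xi>) *
         (attn_odd (attn_C W) n k (x, w, \<xi>) + attn_even (attn_B W) (attn_u W) (attn_e W) n k (x, w, \<xi>)))"
proof -
  obtain Q K V where W: "W = (Q, K, V)" by (cases W)
  let ?z = "(x, w, \<xi>)"
  define Z where "Z = prompt n x (label x w \<xi>)"
  define A where "A = score_mat W"
  define v where "v = value_vec W"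
  have Zi: "Z i $ Some a = feat i a ?z" "i \<in> {1..n} \<Longrightarrow> Z i $ None = resp i ?z" "Z (n + 1) $ None = 0" for i a
    by (simp_all add: Z_def prompt_def feat_def label_eq_resp)
  have score: "(Z (n + 1) v* A) \<bullet> Z i
      = (\<Sum>k\<in>UNIV. feat (n + 1) k ?z * (A $ Some k $ None * resp i ?z + (\<Sum>a\<in>UNIV. A $ Some k $ Some a * feat i a ?z)))"
    if "i \<in> {1..n}" for i
  proof -
    have "(Z (n + 1) v* A) \<bullet> Z i = Z (n + 1) \<bullet> (A *v Z i)" by (simp add: dot_lmul_matrix)
    also have "\<dots> = (\<Sum>j\<in>UNIV. Z (n + 1) $ j * (\<Sum>l\<in>UNIV. A $ j $ l * Z i $ l))"
      by (simp add: inner_vec_def matrix_vector_mult_def)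
    finally show ?thesis using Zi that by (simp add: sum_option)
  qed
  have val: "Z i \<bullet> v = resp i ?z * v $ None + (\<Sum>a\<in>UNIV. feat i a ?z * v $ Some a)"
    if "i \<in> {1..n}" for i
    using Zi that by (simp add: inner_vec_def sum_option)
  have "lin_attn W n Z
      = 1 / real n * (\<Sum>i=1..n+1. ((Z (n + 1) v* A) \<bullet> mask n Z i) * (mask n Z i \<bullet> v))"
    by (simp add: lin_attn_def W A_def score_mat_def v_def value_vec_def inner_sum_left del: sum.cl_ivl_Suc)
  also have "(\<Sum>i=1..n+1. ((Z (n + 1) v* A) \<bullet> mask n Z i) * (mask n Z i \<bullet> v))
      = (\<Sum>i=1..n. ((Z (n + 1) v* A) \<bullet> Z i) * (Z i \<bullet> v))"
    by (simp add: mask_def)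
  also have "\<dots> = (\<Sum>i=1..n. \<Sum>k\<in>UNIV. feat (n + 1) k ?z *
      ((\<Sum>a\<in>UNIV. attn_C W $ k $ a * (resp i ?z * feat i a ?z)) +
       ((\<Sum>a\<in>UNIV. \<Sum>b\<in>UNIV. attn_u W $ a * attn_B W $ k $ b * (feat i a ?z * feat i b ?z))
        + attn_e W $ k * (resp i ?z)\<^sup>2)))"
  proof (intro sum.cong refl)
    fix i assume i: "i \<in> {1..n}"
    show "((Z (n + 1) v* A) \<bullet> Z i) * (Z i \<bullet> v) = (\<Sum>k\<in>UNIV. feat (n + 1) k ?z *
      ((\<Sum>a\<in>UNIV. attn_C W $ k $ a * (resp i ?z * feat i a ?z)) +
       ((\<Sum>a\<in>UNIV. \<Sum>b\<in>UNIV. attn_u W $ a * attn_B W $ k $ b * (feat i a ?z * feat i b ?z))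
        + attn_e W $ k * (resp i ?z)\<^sup>2)))"
      unfolding score[OF i] val[OF i] sum_distrib_right[of _ _ "_ + _"]
    proof (intro sum.cong refl)
      fix k :: 'a
      have "(\<Sum>a\<in>UNIV. \<Sum>b\<in>UNIV. attn_u W $ a * attn_B W $ k $ b * (feat i a ?z * feat i b ?z))
          = (\<Sum>a\<in>UNIV. feat i a ?z * v $ Some a) * (\<Sum>b\<in>UNIV. A $ Some k $ Some b * feat i b ?z)"
        by (simp add: sum_product attn_u_def attn_B_def v_def A_def mult_ac)
      moreover have "(\<Sum>a\<in>UNIV. attn_C W $ k $ a * (resp i ?z * feat i a ?z))
          = resp i ?z * v $ None * (\<Sum>b\<in>UNIV. A $ Some k $ Some b * feat i b ?z)
            + resp i ?z * A $ Some k $ None * (\<Sum>a\<in>UNIV. feat i a ?z * v $ Some a)"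
        by (simp add: attn_C_def v_def A_def sum_distrib_left sum.distrib algebra_simps)
      moreover have "attn_e W $ k = v $ None * A $ Some k $ None"
        by (simp add: attn_e_def v_def A_def)
      ultimately show "feat (n + 1) k ?z * (A $ Some k $ None * resp i ?z
          + (\<Sum>a\<in>UNIV. A $ Some k $ Some a * feat i a ?z)) *
          (resp i ?z * v $ None + (\<Sum>a\<in>UNIV. feat i a ?z * v $ Some a))
        = feat (n + 1) k ?z * ((\<Sum>a\<in>UNIV. attn_C W $ k $ a * (resp i ?z * feat i a ?z)) +
         ((\<Sum>a\<in>UNIV. \<Sum>b\<in>UNIV. attn_u W $ a * attn_B W $ k $ b * (feat i a ?z * feat i b ?z))
          + attn_e W $ k * (resp i ?z)\<^sup>2))"
        by (simp add: power2_eq_square algebra_simps)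
    qed
  qed
  also have "1 / real n * \<dots> = (\<Sum>k\<in>UNIV. feat (n + 1) k ?z *
      (attn_odd (attn_C W) n k ?z + attn_even (attn_B W) (attn_u W) (attn_e W) n k ?z))"
    by (subst sum.swap)
      (simp add: attn_odd_def attn_even_def sum_distrib_left sum.distrib distrib_left mult_ac)
  finally show ?thesis by (simp add: Z_def)
qed

text \<open>Second moment matrix of the average of the y_i x_i: each of the n^2 pairs of examples
  contributes \<open>S\<close>, and the n diagonal pairs add the terms carrying 1/n.\<close>

definition cov_noisy :: "real \<Rightarrow> real ^ 'd ^ 'd \<Rightarrow> nat \<Rightarrow> real ^ 'd ^ 'd" where
  "cov_noisy \<sigma> S n = S + (1 / real n) *\<^sub>R (S + (trace S + \<sigma>\<^sup>2) *\<^sub>R mat 1)"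

definition lin_risk :: "real \<Rightarrow> real ^ 'd ^ 'd \<Rightarrow> nat \<Rightarrow> real ^ 'd ^ 'd \<Rightarrow> real" where
  "lin_risk \<sigma> S n C = trace S - 2 * (C \<bullet> S) + (C ** cov_noisy \<sigma> S n) \<bullet> C"

section \<open>Odd and even contributions to the risk\<close>

context regression_data begin

lemma moments_odd: "all_moments M (\<lambda>z. attn_odd C n k z)"
  unfolding attn_odd_def by (intro moments_intros) simp_all

lemma moments_even: "all_moments M (\<lambda>z. attn_even B u e n k z)"
  unfolding attn_even_def by (intro moments_intros) simp_all

text \<open>The error vector \<open>D\<close> ignores the query example, whose features have
  identity covariance. The squared inner product with the query thus averages to the squared length
  of \<open>D\<close>; the query noise adds \<sigma>^2, and its cross term has mean zero.\<close>

lemma risk_expand: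
  "risk \<sigma> \<mu> n W = \<sigma>\<^sup>2 + (\<Sum>k\<in>UNIV. \<integral>z. (task k z - attn_odd (attn_C W) n k z
      - attn_even (attn_B W) (attn_u W) (attn_e W) n k z)\<^sup>2 \<partial>M)"
proof -
  let ?q = "n + 1"
  have q: "?q \<in> {1..n+1}" by simp
  define D where "D k z = task k z - attn_odd (attn_C W) n k z
      - attn_even (attn_B W) (attn_u W) (attn_e W) n k z" for k z
  have mD: "all_moments M (\<lambda>z. D k z)" for k
    unfolding D_def by (intro moments_intros moments_odd moments_even)
  have fD: "free_of ?q (\<lambda>z. D k z)" for k
    unfolding D_def attn_odd_def attn_even_def by (intro free_of_intros) simp_all
  have "risk \<sigma> \<mu> n W = (\<integral>z. (resp ?q z - (\<Sum>k\<in>UNIV. feat ?q k z *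
      (attn_odd (attn_C W) n k z + attn_even (attn_B W) (attn_u W) (attn_e W) n k z)))\<^sup>2 \<partial>M)"
    unfolding risk_def lin_attn_eq by (simp add: split_def label_eq_resp)
  also have "\<dots> = (\<integral>z. ((\<Sum>k\<in>UNIV. feat ?q k z * D k z) + err ?q z)\<^sup>2 \<partial>M)"
    by (intro Bochner_Integration.integral_cong refl arg_cong[where f = "\<lambda>t. t\<^sup>2"])
      (simp add: resp_def D_def sum_subtractf sum.distrib algebra_simps)
  also have "\<dots> = (\<integral>z. (\<Sum>k\<in>UNIV. \<Sum>l\<in>UNIV. feat ?q k z * feat ?q l z * (D k z * D l z))
        + (\<Sum>k\<in>UNIV. 2 * (feat ?q k z * err ?q z * D k z)) + (err ?q z)\<^sup>2 * 1 \<partial>M)"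
    by (simp add: power2_eq_square sum_product sum_distrib_left sum_distrib_right sum.distrib algebra_simps)
  also have "\<dots> = (\<Sum>k\<in>UNIV. \<Sum>l\<in>UNIV. (\<integral>z. feat ?q k z * feat ?q l z * (D k z * D l z) \<partial>M))
        + (\<Sum>k\<in>UNIV. 2 * (\<integral>z. feat ?q k z * err ?q z * D k z \<partial>M)) + (\<integral>z. (err ?q z)\<^sup>2 * 1 \<partial>M)"
    by (simp add: integrable_intros mD)
  also have "\<dots> = (\<Sum>k\<in>UNIV. \<Sum>l\<in>UNIV. of_bool (k = l) * (\<integral>z. D k z * D l z \<partial>M)) + \<sigma>\<^sup>2"
    unfolding integral_fresh_feat_2(1)[OF q all_moments_mult[OF mD mD] free_of_mult[OF fD fD]]
      integral_fresh_noise(1)[OF q mD fD]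
      integral_fresh_noise(3)[OF q M.all_moments_const free_of_const]
    using M.prob_space by simp
  also have "\<dots> = (\<Sum>k\<in>UNIV. \<integral>z. (D k z)\<^sup>2 \<partial>M) + \<sigma>\<^sup>2"
    by (simp add: of_bool_def if_distrib[of "\<lambda>x. x * _"] power2_eq_square cong: if_cong)
  finally show ?thesis by (simp add: D_def)
qed

text \<open>\<open>compose\<close> restricts the negated noise to the index set, so that it stays an
  extensional function, as the product space requires.\<close>

definition flip :: "'d sample \<Rightarrow> 'd sample" where
  "flip z = (fst z, - fst (snd z), compose {1..n+1} uminus (snd (snd z)))"

lemma distr_flip: "distr M M flip = M" and measurable_flip: "flip \<in> measurable M M"
proof -
  let ?X = "\<Pi>\<^sub>M i\<in>{1..n+1}. mvnormal (mat 1 :: real ^ 'd ^ 'd)" and ?N = "\<Pi>\<^sub>M i\<in>{1..n+1}. noise \<sigma>"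
  note [measurable_cong] = sets_noise[OF sigma_nonneg]
  have um: "uminus \<in> measurable (noise \<sigma>) (noise \<sigma>)"
    by (subst measurable_cong_sets[OF sets_noise sets_noise]) (simp_all add: sigma_nonneg)
  have umu: "uminus \<in> measurable \<mu> \<mu>"
    by measurable
  have c [measurable]: "compose {1..n+1} uminus \<in> measurable ?N ?N"
    unfolding compose_def
    by (intro measurable_restrict measurable_compose[where g = uminus and f = "\<lambda>\<xi>. \<xi> _", OF _ um]
        measurable_component_singleton)
  have dN: "distr ?N ?N (compose {1..n+1} uminus) = ?N"
    using distr_PiM_finite_prob_space'[of "{1..n+1}" "\<lambda>_. noise \<sigma>" "\<lambda>_. noise \<sigma>" uminus] um
      distr_noise_uminus[OF sigma_nonneg] prob_space_noise[OF sigma_nonneg]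
    by (simp cong: distr_cong add: sets_noise[OF sigma_nonneg])
  have d\<mu>: "distr \<mu> \<mu> uminus = \<mu>"
    using distr_task_uminus by (simp cong: distr_cong)
  interpret N: prob_space ?N by (rule prob_space_noises)
  interpret TN: prob_space "\<mu> \<Otimes>\<^sub>M ?N" by (rule prob_space_task_noises)
  have d1: "distr (\<mu> \<Otimes>\<^sub>M ?N) (\<mu> \<Otimes>\<^sub>M ?N) (\<lambda>(w, \<xi>). (- w, compose {1..n+1} uminus \<xi>)) = \<mu> \<Otimes>\<^sub>M ?N"
    using pair_measure_distr[OF umu c] dN d\<mu> N.sigma_finite_measure_axioms by simp
  have m1: "(\<lambda>(w, \<xi>). (- w, compose {1..n+1} uminus \<xi>)) \<in> measurable (\<mu> \<Otimes>\<^sub>M ?N) (\<mu> \<Otimes>\<^sub>M ?N)"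
    using umu c by measurable
  have flip: "flip = (\<lambda>(x, z). (x, (\<lambda>(w, \<xi>). (- w, compose {1..n+1} uminus \<xi>)) z))"
    by (auto simp: flip_def fun_eq_iff)
  have "distr (?X \<Otimes>\<^sub>M (\<mu> \<Otimes>\<^sub>M ?N)) (?X \<Otimes>\<^sub>M (\<mu> \<Otimes>\<^sub>M ?N)) flip = ?X \<Otimes>\<^sub>M (\<mu> \<Otimes>\<^sub>M ?N)"
    unfolding flip
    using pair_measure_distr[OF measurable_ident_sets[OF refl, of ?X] m1] d1 TN.sigma_finite_measure_axioms
    by (simp add: distr_id2)
  then show "distr M M flip = M" by (simp add: data_law_def)
  have "flip \<in> measurable (?X \<Otimes>\<^sub>M (\<mu> \<Otimes>\<^sub>M ?N)) (?X \<Otimes>\<^sub>M (\<mu> \<Otimes>\<^sub>M ?N))"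
    unfolding flip using m1 by measurable
  then show "flip \<in> measurable M M" by (simp add: data_law_def)
qed

lemma integral_odd_even: "(\<integral>z. (task k z - attn_odd C n k z) * attn_even B u e n k z \<partial>M) = 0"
proof -
  let ?f = "\<lambda>z. (task k z - attn_odd C n k z) * attn_even B u e n k z"
  have fm: "?f \<in> borel_measurable M"
    by (intro all_moments_measurable moments_intros moments_odd moments_even)
  have r: "resp i (flip z) = - resp i z" if "i \<in> {1..n}" for i z
    using that by (simp add: resp_def flip_def task_def feat_def err_def compose_def sum_negf)
  have t: "task k (flip z) = - task k z" and f: "feat i a (flip z) = feat i a z" for z k i a
    by (simp_all add: flip_def task_def feat_def)
  have "attn_odd C n k (flip z) = - attn_odd C n k z" for z
    by (simp add: attn_odd_def r f sum_negf)
  moreover have "attn_even B u e n k (flip z) = attn_even B u e n k z" for z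
    by (simp add: attn_even_def r f)
  ultimately have fl: "?f (flip z) = - ?f z" for z
    by (simp add: t algebra_simps)
  have "(\<integral>z. ?f z \<partial>M) = (\<integral>z. ?f z \<partial>distr M M flip)" by (simp add: distr_flip)
  also have "\<dots> = (\<integral>z. ?f (flip z) \<partial>M)" by (rule integral_distr[OF measurable_flip fm])
  also have "\<dots> = - (\<integral>z. ?f z \<partial>M)" by (simp only: fl integral_minus)
  finally show ?thesis by simp
qed

text \<open>For distinct examples the conditional mean is substituted one example at a time, leaving
  the second moment of the task; for a repeated example the fourth-moment computation
  applies.\<close>

lemma integral_resp_feat_2:
  assumes "i \<in> {1..n}" "j \<in> {1..n}"
  shows "(\<integral>z. resp i z * feat i a z * (resp j z * feat j b z) \<partial>M)
    = S $ a $ b + of_bool (i = j) * (S $ a $ b + of_bool (a = b) * (trace S + \<sigma>\<^sup>2))"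
proof (cases "i = j")
  case True
  have "(\<integral>z. resp i z * feat i a z * (resp i z * feat i b z) \<partial>M)
      = (\<integral>z. (resp i z)\<^sup>2 * (feat i a z * feat i b z) \<partial>M)"
    by (simp add: power2_eq_square mult_ac)
  then show ?thesis using integral_resp_sq_feat_2[of i a b] assms True by simp
next
  case False
  have ij: "i \<in> {1..n+1}" "j \<in> {1..n+1}" using assms by auto
  have "(\<integral>z. resp i z * feat i a z * (resp j z * feat j b z) \<partial>M)
      = (\<integral>z. task a z * (resp j z * feat j b z) \<partial>M)"
    using False ij by (intro integral_resp_feat moments_intros free_of_intros)
  also have "\<dots> = (\<integral>z. resp j z * feat j b z * task a z \<partial>M)" by (simp add: mult_ac)
  also have "\<dots> = (\<integral>z. task b z * task a z \<partial>M)"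
    using ij by (intro integral_resp_feat moments_intros free_of_intros)
  finally show ?thesis using False by (simp add: integral_task_2[symmetric] mult.commute)
qed

lemma integral_odd_square:
  "(\<integral>z. (task k z - attn_odd C n k z)\<^sup>2 \<partial>M)
    = S $ k $ k - 2 * (\<Sum>a\<in>UNIV. C $ k $ a * S $ k $ a)
      + (\<Sum>a\<in>UNIV. \<Sum>b\<in>UNIV. C $ k $ a * C $ k $ b * cov_noisy \<sigma> S n $ a $ b)"
proof -
  define N where "N = real n"
  have N: "N > 0" using n_pos by (simp add: N_def)
  let ?I = "{1..n}"
  have lin: "(\<integral>z. task k z * attn_odd C n k z \<partial>M) = (\<Sum>a\<in>UNIV. C $ k $ a * S $ k $ a)"
  proof -
    have "(\<integral>z. task k z * attn_odd C n k z \<partial>M)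
        = (\<integral>z. 1 / N * (\<Sum>i\<in>?I. \<Sum>a\<in>UNIV. C $ k $ a * (resp i z * feat i a z * task k z)) \<partial>M)"
      by (simp add: attn_odd_def N_def sum_distrib_left mult_ac)
    also have "\<dots> = 1 / N * (\<Sum>i\<in>?I. \<Sum>a\<in>UNIV. C $ k $ a * (\<integral>z. resp i z * feat i a z * task k z \<partial>M))"
      by (simp add: integrable_intros)
    also have "(\<Sum>i\<in>?I. \<Sum>a\<in>UNIV. C $ k $ a * (\<integral>z. resp i z * feat i a z * task k z \<partial>M))
        = (\<Sum>i\<in>?I. \<Sum>a\<in>UNIV. C $ k $ a * S $ k $ a)"
    proof (intro sum.cong refl)
      fix i a assume "i \<in> ?I"
      then have "(\<integral>z. resp i z * feat i a z * task k z \<partial>M) = (\<integral>z. task a z * task k z \<partial>M)"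
        by (intro integral_resp_feat moments_intros free_of_intros) simp
      then show "C $ k $ a * (\<integral>z. resp i z * feat i a z * task k z \<partial>M) = C $ k $ a * S $ k $ a"
        by (simp add: mult.commute[of "task a _"] integral_task_2)
    qed
    finally show ?thesis using N by (simp add: N_def)
  qed
  \<comment> \<open>\<open>s\<close> is what every pair of examples contributes, \<open>h\<close>
    the surplus of a pair with equal indices.\<close>
  define s where "s = (\<Sum>a\<in>UNIV. \<Sum>b\<in>UNIV. C $ k $ a * C $ k $ b * S $ a $ b)"
  define h where "h = (\<Sum>a\<in>UNIV. \<Sum>b\<in>UNIV. C $ k $ a * C $ k $ b
      * (S $ a $ b + of_bool (a = b) * (trace S + \<sigma>\<^sup>2)))"
  have int: "integrable M (\<lambda>z. resp i z * feat i a z * (resp j z * feat j b z))"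
    if "i \<in> ?I" "j \<in> ?I" for i j a b
    using that by (intro integrable_intros) simp_all
  define F where "F i j z = (\<Sum>a\<in>UNIV. \<Sum>b\<in>UNIV.
    C $ k $ a * C $ k $ b * (resp i z * feat i a z * (resp j z * feat j b z)))" for i j z
  have intF: "integrable M (F i j)" and valF: "(\<integral>z. F i j z \<partial>M) = (\<Sum>a\<in>UNIV. \<Sum>b\<in>UNIV.
    C $ k $ a * C $ k $ b * (\<integral>z. resp i z * feat i a z * (resp j z * feat j b z) \<partial>M))"
    if "i \<in> ?I" "j \<in> ?I" for i j
    unfolding F_def[abs_def] using int[OF that] by simp_all
  have quad: "(\<integral>z. (attn_odd C n k z)\<^sup>2 \<partial>M) = s + h / N"
  proof -
    have "(\<integral>z. (attn_odd C n k z)\<^sup>2 \<partial>M) = (\<integral>z. 1 / N\<^sup>2 * (\<Sum>i\<in>?I. \<Sum>j\<in>?I. F i j z) \<partial>M)"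
      by (simp add: attn_odd_def F_def N_def power2_eq_square sum_product mult_ac)
    also have "\<dots> = 1 / N\<^sup>2 * (\<Sum>i\<in>?I. \<Sum>j\<in>?I. \<integral>z. F i j z \<partial>M)"
    proof -
      have "(\<integral>z. (\<Sum>i\<in>?I. \<Sum>j\<in>?I. F i j z) \<partial>M) = (\<Sum>i\<in>?I. \<integral>z. (\<Sum>j\<in>?I. F i j z) \<partial>M)"
        by (intro Bochner_Integration.integral_sum Bochner_Integration.integrable_sum intF)
      also have "\<dots> = (\<Sum>i\<in>?I. \<Sum>j\<in>?I. \<integral>z. F i j z \<partial>M)"
        by (intro sum.cong refl Bochner_Integration.integral_sum intF)
      finally show ?thesis by simp
    qed
    also have "(\<Sum>i\<in>?I. \<Sum>j\<in>?I. \<integral>z. F i j z \<partial>M) = (\<Sum>i\<in>?I. \<Sum>j\<in>?I. s + of_bool (i = j) * h)"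
    proof (intro sum.cong refl)
      fix i j assume "i \<in> ?I" "j \<in> ?I"
      then show "(\<integral>z. F i j z \<partial>M) = s + of_bool (i = j) * h"
        by (simp add: valF integral_resp_feat_2 s_def h_def sum.distrib distrib_left sum_distrib_left)
    qed
    also have "\<dots> = N\<^sup>2 * s + N * h"
      by (simp add: sum.distrib N_def power2_eq_square distrib_left of_bool_def if_distrib[of "\<lambda>x. x * _"] cong: if_cong)
    also have "1 / N\<^sup>2 * (N\<^sup>2 * s + N * h) = s + h / N"
      using N by (simp add: field_simps power2_eq_square)
    finally show ?thesis .
  qed
  have "(\<integral>z. (task k z - attn_odd C n k z)\<^sup>2 \<partial>M)
      = (\<integral>z. task k z * task k z - 2 * (task k z * attn_odd C n k z) + (attn_odd C n k z)\<^sup>2 \<partial>M)"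
    by (simp add: power2_eq_square algebra_simps)
  also have "\<dots> = (\<integral>z. task k z * task k z \<partial>M) - 2 * (\<integral>z. task k z * attn_odd C n k z \<partial>M)
      + (\<integral>z. (attn_odd C n k z)\<^sup>2 \<partial>M)"
    by (simp add: integrable_intros moments_odd)
  also have "\<dots> = S $ k $ k - 2 * (\<Sum>a\<in>UNIV. C $ k $ a * S $ k $ a) + (s + h / N)"
    by (simp add: integral_task_2 lin quad)
  also have "s + h / N = (\<Sum>a\<in>UNIV. \<Sum>b\<in>UNIV. C $ k $ a * C $ k $ b * cov_noisy \<sigma> S n $ a $ b)"
    by (simp add: s_def h_def cov_noisy_def N_def mat_def sum.distrib[symmetric] sum_divide_distrib)
      (intro sum.cong refl, simp add: field_simps)
  finally show ?thesis .
qed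

lemma risk_eq:
  "risk \<sigma> \<mu> n W = \<sigma>\<^sup>2 + lin_risk \<sigma> S n (attn_C W)
     + (\<Sum>k\<in>UNIV. \<integral>z. (attn_even (attn_B W) (attn_u W) (attn_e W) n k z)\<^sup>2 \<partial>M)"
proof -
  let ?C = "attn_C W" and ?E = "\<lambda>k z. attn_even (attn_B W) (attn_u W) (attn_e W) n k z"
  have "(\<integral>z. (task k z - attn_odd ?C n k z - ?E k z)\<^sup>2 \<partial>M)
      = (\<integral>z. (task k z - attn_odd ?C n k z)\<^sup>2 \<partial>M) + (\<integral>z. (?E k z)\<^sup>2 \<partial>M)" for k
  proof -
    have "(\<integral>z. (task k z - attn_odd ?C n k z - ?E k z)\<^sup>2 \<partial>M)
      = (\<integral>z. (task k z - attn_odd ?C n k z)\<^sup>2 - 2 * ((task k z - attn_odd ?C n k z) * ?E k z) + (?E k z)\<^sup>2 \<partial>M)"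
      by (simp add: power2_eq_square algebra_simps)
    also have "\<dots> = (\<integral>z. (task k z - attn_odd ?C n k z)\<^sup>2 \<partial>M)
        - 2 * (\<integral>z. (task k z - attn_odd ?C n k z) * ?E k z \<partial>M) + (\<integral>z. (?E k z)\<^sup>2 \<partial>M)"
      by (simp add: integrable_intros moments_odd moments_even)
    finally show ?thesis by (simp add: integral_odd_even)
  qed
  moreover have "(\<Sum>k\<in>UNIV. \<integral>z. (task k z - attn_odd ?C n k z)\<^sup>2 \<partial>M) = lin_risk \<sigma> S n ?C"
  proof -
    have "(?C ** cov_noisy \<sigma> S n) \<bullet> ?C
        = (\<Sum>k\<in>UNIV. \<Sum>b\<in>UNIV. \<Sum>a\<in>UNIV. ?C $ k $ a * ?C $ k $ b * cov_noisy \<sigma> S n $ a $ b)"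
      by (simp add: inner_vec_def matrix_matrix_mult_def sum_distrib_right sum_distrib_left mult_ac)
    also have "\<dots> = (\<Sum>k\<in>UNIV. \<Sum>a\<in>UNIV. \<Sum>b\<in>UNIV. ?C $ k $ a * ?C $ k $ b * cov_noisy \<sigma> S n $ a $ b)"
      by (intro sum.cong refl sum.swap)
    finally show ?thesis
      by (simp add: integral_odd_square lin_risk_def sum.distrib sum_subtractf trace_def inner_vec_def
          sum_distrib_left)
  qed
  ultimately show ?thesis by (simp add: risk_expand sum.distrib)
qed

end

section \<open>Consequences of a vanishing even part\<close>

lemma sum_of_bool_diagonal:
  fixes g :: "'a :: finite \<Rightarrow> 'a \<Rightarrow> real"
  shows "(\<Sum>a\<in>UNIV. \<Sum>b\<in>UNIV. g a b * (of_bool (a = b) * c)) = (\<Sum>a\<in>UNIV. g a a) * c"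
proof -
  have "(\<Sum>b\<in>UNIV. g a b * (of_bool (a = b) * c)) = (\<Sum>b\<in>UNIV. if a = b then g a a * c else 0)" for a
    by (intro sum.cong) auto
  then show ?thesis by (simp add: sum_distrib_right)
qed

lemma integral_cmult_sum:
  fixes F :: "'i \<Rightarrow> 'a \<Rightarrow> real"
  assumes "\<And>i. i \<in> I \<Longrightarrow> integrable M (F i)"
  shows "(\<integral>z. c * (\<Sum>i\<in>I. F i z) \<partial>M) = c * (\<Sum>i\<in>I. \<integral>z. F i z \<partial>M)"
  using assms by (simp add: Bochner_Integration.integral_sum)

context regression_data begin

text \<open>The factor of \<open>f\<close> on the right is the conditional mean of the even part
  given the task. Each context example has the same conditional mean, so the division by
  \<open>n\<close> cancels.\<close>

lemma integral_even_fresh: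
  assumes mf: "all_moments M f" and ff: "\<And>i. i \<in> {1..n} \<Longrightarrow> free_of i f"
  shows "(\<integral>z. attn_even B u e n k z * f z \<partial>M)
    = (\<integral>z. ((\<Sum>a\<in>UNIV. u $ a * B $ k $ a) + e $ k * ((\<Sum>c\<in>UNIV. (task c z)\<^sup>2) + \<sigma>\<^sup>2)) * f z \<partial>M)"
proof -
  define p where "p z = (\<Sum>a\<in>UNIV. u $ a * B $ k $ a) + e $ k * ((\<Sum>c\<in>UNIV. (task c z)\<^sup>2) + \<sigma>\<^sup>2)" for z :: "'d sample"
  have "(\<integral>z. attn_even B u e n k z * f z \<partial>M)
      = (\<integral>z. 1 / real n * (\<Sum>i=1..n. (\<Sum>a\<in>UNIV. \<Sum>b\<in>UNIV. u $ a * B $ k $ b * (feat i a z * feat i b z * f z))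
          + e $ k * ((resp i z)\<^sup>2 * f z)) \<partial>M)"
    by (simp only: attn_even_def mult.assoc sum_distrib_right distrib_right)
  also have "\<dots> = 1 / real n * (\<Sum>i=1..n. (\<Sum>a\<in>UNIV. \<Sum>b\<in>UNIV. u $ a * B $ k $ b * (\<integral>z. feat i a z * feat i b z * f z \<partial>M))
          + e $ k * (\<integral>z. (resp i z)\<^sup>2 * f z \<partial>M))"
  proof -
    define F where "F i z = (\<Sum>a\<in>UNIV. \<Sum>b\<in>UNIV. u $ a * B $ k $ b * (feat i a z * feat i b z * f z))
          + e $ k * ((resp i z)\<^sup>2 * f z)" for i z
    have int: "integrable M (\<lambda>z. feat i a z * feat i b z * f z)" "integrable M (\<lambda>z. (resp i z)\<^sup>2 * f z)"
      if "i \<in> {1..n}" for i a b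
      using that by (intro integrable_intros mf; simp)+
    have F: "integrable M (F i)" and F': "(\<integral>z. F i z \<partial>M)
        = (\<Sum>a\<in>UNIV. \<Sum>b\<in>UNIV. u $ a * B $ k $ b * (\<integral>z. feat i a z * feat i b z * f z \<partial>M))
          + e $ k * (\<integral>z. (resp i z)\<^sup>2 * f z \<partial>M)" if "i \<in> {1..n}" for i
      unfolding F_def[abs_def] using int[OF that] by simp_all
    have "(\<integral>z. 1 / real n * (\<Sum>i=1..n. F i z) \<partial>M) = 1 / real n * (\<Sum>i=1..n. \<integral>z. F i z \<partial>M)"
      by (intro integral_cmult_sum F)
    then show ?thesis
      unfolding F_def[symmetric] by (simp only: F' cong: sum.cong)
  qed
  also have "\<dots> = 1 / real n * (\<Sum>i=1..n. (\<integral>z. p z * f z \<partial>M))"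
  proof (intro arg_cong2[where f = "(*)"] refl sum.cong)
    fix i assume i: "i \<in> {1..n}"
    have "(\<integral>z. p z * f z \<partial>M) = (\<integral>z. (\<Sum>a\<in>UNIV. u $ a * B $ k $ a) * f z
        + e $ k * (((\<Sum>c\<in>UNIV. (task c z)\<^sup>2) + \<sigma>\<^sup>2) * f z) \<partial>M)"
      by (simp add: p_def algebra_simps)
    also have "\<dots> = (\<Sum>a\<in>UNIV. u $ a * B $ k $ a) * (\<integral>z. f z \<partial>M)
        + e $ k * (\<integral>z. ((\<Sum>c\<in>UNIV. (task c z)\<^sup>2) + \<sigma>\<^sup>2) * f z \<partial>M)"
      by (simp add: integrable_intros mf)
    finally show "(\<Sum>a\<in>UNIV. \<Sum>b\<in>UNIV. u $ a * B $ k $ b * (\<integral>z. feat i a z * feat i b z * f z \<partial>M))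
          + e $ k * (\<integral>z. (resp i z)\<^sup>2 * f z \<partial>M) = (\<integral>z. p z * f z \<partial>M)"
      using i integral_resp_sq[of i f]
      by (simp add: integral_fresh_feat_2 mf ff sum_of_bool_diagonal)
  qed
  finally show ?thesis using n_pos by (simp add: p_def)
qed

text \<open>Two kinds of test functions turn vanishing in mean square into identities between
  coefficients, free of the prompt length and the task law: a function of the task isolates
  \<open>e $ k\<close>, and products of two coordinates of one example isolate the symmetric part of
  the outer product of \<open>u\<close> and \<open>B $ k\<close>.\<close>

lemma even_part_vanishes:
  assumes mu: "\<mu> = density lborel (\<lambda>v. ennreal (g v))" and g: "g \<in> borel_measurable borel" "\<And>v. 0 < g v"
    and zero: "(\<integral>z. (attn_even B u e n k z)\<^sup>2 \<partial>M) = 0"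
  shows "e $ k = 0" and "u = 0 \<or> B $ k = 0"
proof -
  have AE: "AE z in M. attn_even B u e n k z = 0"
    by (rule M.integral_zero_AE_square[OF moments_even zero])
  \<comment> \<open>Testing against the conditional mean \<open>p\<close> of the even part given the task yields \<open>p = 0\<close>.\<close>
  have orth: "(\<integral>z. attn_even B u e n k z * f z \<partial>M) = 0" for f
  proof (rule integral_eq_zero_AE)
    show "AE z in M. attn_even B u e n k z * f z = 0" using AE by eventually_elim simp
  qed
  define \<beta> where "\<beta> = (\<Sum>a\<in>UNIV. u $ a * B $ k $ a)"
  define p where "p w = \<beta> + e $ k * ((\<Sum>c\<in>UNIV. (w $ c)\<^sup>2) + \<sigma>\<^sup>2)" for w :: "real ^ 'd"
  have pz: "p (fst (snd z)) = \<beta> + e $ k * ((\<Sum>c\<in>UNIV. (task c z)\<^sup>2) + \<sigma>\<^sup>2)" for z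
    by (simp add: p_def task_def)
  have "(\<integral>z. attn_even B u e n k z * p (fst (snd z)) \<partial>M) = (\<integral>z. p (fst (snd z)) * p (fst (snd z)) \<partial>M)"
    unfolding pz by (subst integral_even_fresh) (auto intro!: moments_intros free_of_intros simp: \<beta>_def)
  then have "(\<integral>z. (p (fst (snd z)))\<^sup>2 \<partial>M) = 0"
    by (simp add: orth power2_eq_square)
  moreover have [measurable]: "p \<in> borel_measurable borel" unfolding p_def by measurable
  ultimately have "(\<integral>w. (p w)\<^sup>2 \<partial>\<mu>) = 0"
    using integral_task[of "\<lambda>w. (p w)\<^sup>2"] by simp
  moreover have "all_moments \<mu> p"
    unfolding p_def
    by (intro all_moments_add all_moments_mult all_moments_sum all_moments_power all_moments_const task_moments)
  ultimately have "AE w in \<mu>. p w = 0" by (intro integral_zero_AE_square)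
  then have AEp: "AE w in density lborel (\<lambda>v. ennreal (g v)). p w = 0" by (simp only: mu)
  have "continuous_on UNIV p" unfolding p_def by (intro continuous_intros)
  from continuous_AE_density_imp_all[OF g this AEp] have p0: "p w = 0" for w .
  obtain c :: 'd where True by simp
  \<comment> \<open>The values of \<open>p\<close> at 0 and at a unit vector differ by exactly
    \<open>e $ k\<close>.\<close>
  have "p 0 = \<beta> + e $ k * \<sigma>\<^sup>2" by (simp add: p_def)
  moreover have "p (axis c 1) = \<beta> + e $ k * (1 + \<sigma>\<^sup>2)"
    by (simp add: p_def axis_def if_distrib[of "\<lambda>x. x\<^sup>2"] cong: if_cong)
  ultimately show e0: "e $ k = 0" using p0[of 0] p0[of "axis c 1"] by (simp add: algebra_simps)
  with p0[of 0] have \<beta>0: "\<beta> = 0" by (simp add: p_def)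
  \<comment> \<open>Tested against two coordinates of example 1, the other examples give multiples
    of \<beta> = 0; at example 1 the pairing that yields \<beta> drops out as well, and the two
    crossed pairings remain.\<close>
  have uB: "u $ a * B $ k $ b + u $ b * B $ k $ a = 0" for a b
  proof -
    let ?f = "\<lambda>z. feat 1 a z * feat 1 b z"
    have one: "1 \<in> {1..n+1}" by simp
    have "(\<integral>z. attn_even B u e n k z * ?f z \<partial>M)
        = (\<integral>z. 1 / real n * (\<Sum>i=1..n. \<Sum>c\<in>UNIV. \<Sum>d\<in>UNIV. u $ c * B $ k $ d * (feat i c z * feat i d z * ?f z)) \<partial>M)"
      by (simp only: attn_even_def e0 mult_zero_left add_0_right mult.assoc sum_distrib_right)
    also have "\<dots> = 1 / real n * (\<Sum>i=1..n. \<Sum>c\<in>UNIV. \<Sum>d\<in>UNIV. u $ c * B $ k $ d * (\<integral>z. feat i c z * feat i d z * ?f z \<partial>M))"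
    proof -
      define F where "F i z = (\<Sum>c\<in>UNIV. \<Sum>d\<in>UNIV. u $ c * B $ k $ d * (feat i c z * feat i d z * ?f z))" for i z
      have int: "integrable M (\<lambda>z. feat i c z * feat i d z * ?f z)" if "i \<in> {1..n}" for i c d
        using that n_pos by (intro integrable_intros) simp_all
      have F: "integrable M (F i)" and F': "(\<integral>z. F i z \<partial>M)
          = (\<Sum>c\<in>UNIV. \<Sum>d\<in>UNIV. u $ c * B $ k $ d * (\<integral>z. feat i c z * feat i d z * ?f z \<partial>M))"
        if "i \<in> {1..n}" for i
        unfolding F_def[abs_def] using int[OF that] by simp_all
      have "(\<integral>z. 1 / real n * (\<Sum>i=1..n. F i z) \<partial>M) = 1 / real n * (\<Sum>i=1..n. \<integral>z. F i z \<partial>M)"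
        by (intro integral_cmult_sum F)
      then show ?thesis
        unfolding F_def[symmetric] by (simp only: F' cong: sum.cong)
    qed
    also have "(\<Sum>i=1..n. \<Sum>c\<in>UNIV. \<Sum>d\<in>UNIV. u $ c * B $ k $ d * (\<integral>z. feat i c z * feat i d z * ?f z \<partial>M))
        = (\<Sum>i=1..n. if i = 1 then u $ a * B $ k $ b + u $ b * B $ k $ a else 0)"
    proof (intro sum.cong refl)
      fix i assume i: "i \<in> {1..n}"
      show "(\<Sum>c\<in>UNIV. \<Sum>d\<in>UNIV. u $ c * B $ k $ d * (\<integral>z. feat i c z * feat i d z * ?f z \<partial>M))
          = (if i = 1 then u $ a * B $ k $ b + u $ b * B $ k $ a else 0)"
      proof (cases "i = 1")
        case True
        have I: "(\<integral>z. feat i c z * feat i d z * ?f z \<partial>M)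
            = of_bool (c = d \<and> a = b) + of_bool (c = a \<and> d = b) + of_bool (c = b \<and> d = a)" for c d
          using integral_fresh_feat_4[OF one M.all_moments_const[of 1] free_of_const, of c d a b] True
            M.prob_space by (simp add: mult.assoc)
        have "(\<Sum>c\<in>UNIV. \<Sum>d\<in>UNIV. of_bool (c = d \<and> a = b) * (u $ c * B $ k $ d)) = of_bool (a = b) * \<beta>"
          by (simp add: \<beta>_def of_bool_def if_distrib[of "\<lambda>x. x * _"] cong: if_cong)
        then have "(\<Sum>c\<in>UNIV. \<Sum>d\<in>UNIV. (of_bool (c = d \<and> a = b) + of_bool (c = a \<and> d = b)
            + of_bool (c = b \<and> d = a)) * (u $ c * B $ k $ d)) = u $ a * B $ k $ b + u $ b * B $ k $ a"
          by (simp only: distrib_right sum.distrib sum_of_bool_pair[of _ _ "\<lambda>c d. u $ c * B $ k $ d"] \<beta>0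
              mult_zero_right add_0_left)
        then show ?thesis unfolding I using True by (simp add: mult.commute)
      next
        case False
        have I: "(\<integral>z. feat i c z * feat i d z * ?f z \<partial>M) = of_bool (c = d) * (\<integral>z. ?f z \<partial>M)" for c d
          using False i n_pos by (intro integral_fresh_feat_2 moments_intros free_of_intros) auto
        have "(\<Sum>c\<in>UNIV. \<Sum>d\<in>UNIV. u $ c * B $ k $ d * (of_bool (c = d) * (\<integral>z. ?f z \<partial>M)))
            = \<beta> * (\<integral>z. ?f z \<partial>M)"
          by (simp add: \<beta>_def sum_of_bool_diagonal)
        then show ?thesis unfolding I using False by (simp add: \<beta>0)
      qed
    qed
    also have "\<dots> = u $ a * B $ k $ b + u $ b * B $ k $ a" using n_pos by simp
    finally show ?thesis using orth[of ?f] n_pos by simp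
  qed
  show "u = 0 \<or> B $ k = 0"
  proof (rule disjCI)
    assume "B $ k \<noteq> 0"
    then obtain b where b: "B $ k $ b \<noteq> 0" by (auto simp: vec_eq_iff)
    \<comment> \<open>Taking both indices equal kills \<open>u\<close> where \<open>B $ k\<close> is
      nonzero; the relation with this index then kills every other entry of
      \<open>u\<close>.\<close>
    then have "u $ b = 0" using uB[of b b] by simp
    then have "u $ a = 0" for a using uB[of a b] b by simp
    then show "u = 0" by (simp add: vec_eq_iff)
  qed
qed

end

section \<open>Optimal weights and the limit\<close>

lemma inner_matrix_mult:
  fixes A :: "real ^ 'n ^ 'm" and B :: "real ^ 'p ^ 'n"
  shows "(A ** B) \<bullet> D = A \<bullet> (D ** transpose B)"
proof -
  have "(A ** B) \<bullet> D = (\<Sum>i\<in>UNIV. \<Sum>j\<in>UNIV. \<Sum>k\<in>UNIV. A $ i $ k * B $ k $ j * D $ i $ j)"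
    by (simp add: inner_vec_def matrix_matrix_mult_def sum_distrib_right)
  also have "\<dots> = (\<Sum>i\<in>UNIV. \<Sum>k\<in>UNIV. \<Sum>j\<in>UNIV. A $ i $ k * B $ k $ j * D $ i $ j)"
    by (intro sum.cong refl sum.swap)
  also have "\<dots> = A \<bullet> (D ** transpose B)"
    by (simp add: inner_vec_def matrix_matrix_mult_def transpose_def sum_distrib_left mult_ac)
  finally show ?thesis .
qed

lemma trace_eq_inner: "trace A = mat 1 \<bullet> A" for A :: "real ^ 'd ^ 'd"
  by (simp add: trace_def inner_vec_def mat_def if_distrib[of "\<lambda>x. x * _"] cong: if_cong)

lemma transpose_add: "transpose (A + B) = transpose A + transpose B"
  by (simp add: transpose_def vec_eq_iff)

lemma transpose_sum: "transpose (\<Sum>i\<in>I. A i) = (\<Sum>i\<in>I. transpose (A i))" for A :: "_ \<Rightarrow> real ^ 'n ^ 'm"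
  by (simp add: transpose_def vec_eq_iff)

lemma transpose_cov_noisy: "transpose (cov_noisy \<sigma> S n) = cov_noisy \<sigma> S n" if "transpose S = S"
  using that by (simp add: cov_noisy_def transpose_add transpose_scalar)

text \<open>Completing the square around a stationary point: the linear terms cancel because
  \<open>C0\<close> solves the normal equation and \<open>cov_noisy\<close> is symmetric.\<close>

lemma lin_risk_diff:
  assumes "transpose S = S" and "C0 ** cov_noisy \<sigma> S n = S"
  shows "lin_risk \<sigma> S n C = lin_risk \<sigma> S n C0 + ((C - C0) ** cov_noisy \<sigma> S n) \<bullet> (C - C0)"
proof -
  let ?G = "cov_noisy \<sigma> S n"
  have "(C ** ?G) \<bullet> C0 = C \<bullet> S"
    using assms by (simp add: inner_matrix_mult transpose_cov_noisy)
  then show ?thesis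
    by (simp add: lin_risk_def matrix_mult.diff_left inner_diff_left inner_diff_right assms(2) inner_commute)
qed

lemma tendsto_lin_risk:
  fixes C S :: "'a \<Rightarrow> real ^ 'd ^ 'd"
  assumes "(S \<longlongrightarrow> S0) F" and "(C \<longlongrightarrow> C0) F"
  shows "((\<lambda>x. lin_risk \<sigma> (S x) n (C x)) \<longlongrightarrow> lin_risk \<sigma> S0 n C0) F"
  \<comment> \<open>As an inner product, the trace is covered by the limit rules for bilinear
    maps.\<close>
  unfolding lin_risk_def cov_noisy_def trace_eq_inner
  by (intro tendsto_intros matrix_mult.tendsto assms)

text \<open>The competitor in the optimality comparison, realising any \<open>C\<close> without an
  even part: the value vector is the last unit vector, so \<open>attn_u\<close> vanishes, and the
  column \<open>None\<close> of the score matrix is zero, so \<open>attn_e\<close> vanishes.\<close>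

definition linear_weights :: "real ^ 'd ^ 'd \<Rightarrow> 'd::finite weights" where
  "linear_weights C = ((\<chi> i j. case i of None \<Rightarrow> 0 | Some k \<Rightarrow>
     (case j of None \<Rightarrow> 0 | Some a \<Rightarrow> C $ k $ a)), mat 1, mat 1)"

lemma linear_weights_simps:
  "attn_C (linear_weights C) = C" "attn_u (linear_weights C) = 0" "attn_e (linear_weights C) = 0"
  by (simp_all add: linear_weights_def attn_C_def attn_u_def attn_e_def score_mat_def value_vec_def
      vec_eq_iff axis_def)

lemma attn_even_eq_0:
  assumes "e $ k = 0" and "u = 0 \<or> B $ k = 0"
  shows "attn_even B u e n k z = 0"
  using assms by (auto simp: attn_even_def)

context regression_data begin

lemma transpose_S: "transpose S = S"
proof -
  have "S $ a $ b = S $ b $ a" for a b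
    using task_second_moment[of a b] task_second_moment[of b a] by (simp add: mult.commute)
  then show ?thesis by (simp add: transpose_def vec_eq_iff)
qed

text \<open>Comparison with \<open>linear_weights C0\<close> bounds the sum of two nonnegative
  excesses by zero, so both vanish. The second conclusion holds for arbitrary \<open>m\<close> and
  \<open>z\<close> because the coefficients of the even part, not just its values, are
  controlled.\<close>

lemma optimal_weights_imp:
  assumes opt: "optimal_weights \<sigma> \<mu> n W"
    and mu: "\<mu> = density lborel (\<lambda>v. ennreal (g v))" and g: "g \<in> borel_measurable borel" "\<And>v. 0 < g v"
    and C0: "C0 ** cov_noisy \<sigma> S n = S"
    and pos: "\<And>D :: real ^ 'd ^ 'd. D \<noteq> 0 \<Longrightarrow> 0 < (D ** cov_noisy \<sigma> S n) \<bullet> D"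
  shows "attn_C W = C0" and "attn_even (attn_B W) (attn_u W) (attn_e W) m k z = 0"
proof -
  let ?E = "\<lambda>W k. \<integral>z. (attn_even (attn_B W) (attn_u W) (attn_e W) n k z)\<^sup>2 \<partial>M"
  let ?D = "attn_C W - C0"
  have E0: "0 \<le> ?E W k" for W k by (intro integral_nonneg_AE AE_I2) simp
  have "risk \<sigma> \<mu> n W \<le> risk \<sigma> \<mu> n (linear_weights C0)"
    using opt unfolding optimal_weights_def is_arg_min_def by (blast intro: leI)
  also have "\<dots> = \<sigma>\<^sup>2 + lin_risk \<sigma> S n C0"
    by (simp add: risk_eq linear_weights_simps attn_even_eq_0)
  finally have le: "(?D ** cov_noisy \<sigma> S n) \<bullet> ?D + (\<Sum>k\<in>UNIV. ?E W k) \<le> 0"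
    by (simp add: risk_eq lin_risk_diff[OF transpose_S C0, of "attn_C W"])
  have sum0: "0 \<le> (\<Sum>k\<in>UNIV. ?E W k)" by (intro sum_nonneg E0)
  show C: "attn_C W = C0"
    using le sum0 pos[of ?D] by fastforce
  have "(\<Sum>k\<in>UNIV. ?E W k) = 0"
    using le sum0 by (simp add: C matrix_mult.zero_left)
  then have "?E W k = 0"
    by (subst (asm) sum_nonneg_eq_0_iff) (auto intro: E0)
  then show "attn_even (attn_B W) (attn_u W) (attn_e W) m k z = 0"
    using even_part_vanishes[OF mu g] by (intro attn_even_eq_0) blast+
qed

end

section \<open>The iterated limit for a mixture over orthogonal subspaces\<close>

theorem theorem2:
  fixes K :: nat and \<sigma> :: real
    and U :: "nat \<Rightarrow> real ^ 'r ^ 'd"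
    and \<alpha> :: "nat \<Rightarrow> real"
    and Wstar :: "real \<Rightarrow> nat \<Rightarrow> 'd weights"
  assumes "K \<ge> 2" and "CARD('d) \<ge> K * CARD('r)" and "\<sigma> \<ge> 0"
    and "\<And>k. k \<in> {1..K} \<Longrightarrow> transpose (U k) ** U k = mat 1"
    and "\<And>k l. k \<in> {1..K} \<Longrightarrow> l \<in> {1..K} \<Longrightarrow> k \<noteq> l \<Longrightarrow> transpose (U k) ** U l = 0"
    and "\<And>\<epsilon> n. \<epsilon> > 0 \<Longrightarrow> n \<ge> 1 \<Longrightarrow> optimal_weights \<sigma> (task_mixture K U \<epsilon>) n (Wstar \<epsilon> n)"
    and "(\<Sum>k=1..K. (\<alpha> k)\<^sup>2) = 1"
  shows "\<exists>(L1 :: nat \<Rightarrow> nat \<Rightarrow> real) (L2 :: nat \<Rightarrow> real).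
    (\<forall>m\<ge>1. \<forall>n\<ge>1.
       ((\<lambda>\<epsilon>. risk \<sigma> (mvnormal (task_cov (\<Sum>k=1..K. \<alpha> k *\<^sub>R U k) \<epsilon>)) m (Wstar \<epsilon> n))
          \<longlongrightarrow> L1 m n) (at_right 0)) \<and>
    (\<forall>m\<ge>1. (\<lambda>n. L1 m n) \<longlonglongrightarrow> L2 m) \<and>
    L2 \<longlonglongrightarrow> \<sigma>\<^sup>2"
proof -
  note UU = assms(4) and orth = assms(5)
  define V where "V = (\<Sum>k=1..K. \<alpha> k *\<^sub>R U k)"
  define P where "P = (\<Sum>k=1..K. U k ** transpose (U k))"
  define T where "T = V ** transpose V"
  have gram: "transpose (U k) ** U l = of_bool (k = l) *\<^sub>R mat 1" if "k \<in> {1..K}" "l \<in> {1..K}" for k l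
    using UU[of k] orth[of k l] that by (cases "k = l") simp_all
  have PU: "P ** U l = U l" if l: "l \<in> {1..K}" for l
  proof -
    have "P ** U l = (\<Sum>k=1..K. of_bool (k = l) *\<^sub>R U k)"
      unfolding P_def matrix_mult.sum_left matrix_mul_assoc[symmetric]
      using l by (intro sum.cong refl) (simp add: gram matrix_mult.scaleR_right)
    also have "\<dots> = (\<Sum>k=1..K. if k = l then U k else 0)"
      by (intro sum.cong) auto
    finally show ?thesis using l by simp
  qed
  \<comment> \<open>The test directions are combinations of training directions, all fixed by
    \<open>P\<close>; this is how training on the mixture carries over to the test subspace.\<close>
  have PV: "P ** V = V"
    unfolding V_def by (simp add: matrix_mult.sum_right matrix_mult.scaleR_right PU)
  have PT: "P ** T = T" by (simp add: T_def matrix_mul_assoc PV)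
  have trP: "transpose P = P" by (simp add: P_def transpose_sum matrix_transpose_mul)
  have trT: "transpose T = T" by (simp add: T_def matrix_transpose_mul)
  have TP: "T ** P = T"
    using arg_cong[OF PT, of transpose] by (simp add: matrix_transpose_mul trP trT)
  have PP: "P ** P = P"
  proof -
    have "P ** P = (\<Sum>k=1..K. P ** U k ** transpose (U k))"
      by (subst (2) P_def) (simp add: matrix_mult.sum_right matrix_mul_assoc)
    also have "\<dots> = (\<Sum>k=1..K. U k ** transpose (U k))"
      by (simp only: PU cong: sum.cong)
    finally show ?thesis by (simp only: flip: P_def)
  qed
  \<comment> \<open>Mutual orthogonality kills the cross terms and the normalisation of \<alpha>
    settles the rest, so the test law has the same form as the mixture components.\<close>
  have VV: "transpose V ** V = mat 1"
  proof -
    have "transpose V ** V = (\<Sum>k=1..K. \<Sum>l=1..K. (\<alpha> k * \<alpha> l) *\<^sub>R (transpose (U k) ** U l))"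
      unfolding V_def
      by (simp add: transpose_sum transpose_scalar matrix_mult.sum_left matrix_mult.sum_right
          matrix_mult.scaleR_left matrix_mult.scaleR_right scaleR_sum_right)
        (subst sum.swap, simp add: mult.commute)
    also have "\<dots> = (\<Sum>k=1..K. \<Sum>l=1..K. if k = l then (\<alpha> k)\<^sup>2 *\<^sub>R mat 1 else 0)"
      by (intro sum.cong refl) (simp add: gram power2_eq_square)
    also have "\<dots> = (\<Sum>k=1..K. (\<alpha> k)\<^sup>2) *\<^sub>R mat 1"
      by (simp add: scaleR_sum_left)
    finally show ?thesis using assms(7) by simp
  qed
  have trace_P: "trace P = P \<bullet> P"
    by (metis PP inner_commute inner_matrix_mult matrix_mul_lid trP trace_eq_inner)
  \<comment> \<open>Secures \<tau> > 0, hence \<open>g0 0 n > 0\<close>, even when \<epsilon> and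
    \<sigma> are both 0, so that the quotients below keep nonzero denominators in the limit.\<close>
  have "0 < trace P"
  proof -
    have "P \<noteq> 0"
    proof
      assume "P = 0"
      then have "U 1 = 0" using PU[of 1] assms(1) by (simp add: matrix_mult.zero_left)
      then have "mat 1 = (0 :: real ^ 'r ^ 'r)" using UU[of 1] assms(1) by (simp add: matrix_mult.zero_right)
      then have "(mat 1 :: real ^ 'r ^ 'r) $ i $ i = 0" for i by simp
      then show False by (simp add: mat_def)
    qed
    then show ?thesis by (simp add: trace_P)
  qed
  have mult: "(a *\<^sub>R mat 1 + b *\<^sub>R P) ** (a' *\<^sub>R mat 1 + b' *\<^sub>R P)
      = (a * a') *\<^sub>R mat 1 + (a * b' + b * a' + b * b') *\<^sub>R P" for a b a' b' :: real
    by (simp add: matrix_mult.add_left matrix_mult.add_right matrix_mult.scaleR_left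
        matrix_mult.scaleR_right PP algebra_simps)

  define \<kappa> where "\<kappa> = 1 / real K"
  have \<kappa>: "0 < \<kappa>" using assms(1) by (simp add: \<kappa>_def)
  define S where "S \<epsilon> = \<epsilon> *\<^sub>R mat 1 + \<kappa> *\<^sub>R P" for \<epsilon>
  define \<tau> where "\<tau> \<epsilon> = trace (S \<epsilon>) + \<sigma>\<^sup>2" for \<epsilon>
  have \<tau>_eq: "\<tau> \<epsilon> = \<epsilon> * real CARD('d) + \<kappa> * trace P + \<sigma>\<^sup>2" for \<epsilon>
    by (simp add: \<tau>_def S_def trace_eq_inner inner_add_right) (simp add: trace_eq_inner[symmetric] trace_I)
  have \<tau>: "0 < \<tau> \<epsilon>" if "0 \<le> \<epsilon>" for \<epsilon>
    using that \<kappa> \<open>0 < trace P\<close> by (simp add: \<tau>_eq add_nonneg_pos add_pos_nonneg)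
  \<comment> \<open>\<open>S \<epsilon>\<close> and \<open>cov_noisy\<close> are combinations of \<open>I\<close> and \<open>P\<close>: \<open>g0\<close> and \<open>g0 + g1\<close> are the eigenvalues
    of the latter off and on the range of \<open>P\<close>, and \<open>C\<close> is the quotient of the eigenvalues.\<close>
  define g0 where "g0 \<epsilon> n = (1 + 1 / real n) * \<epsilon> + \<tau> \<epsilon> / real n" for \<epsilon> n
  define g1 where "g1 n = (1 + 1 / real n) * \<kappa>" for n
  have g0: "0 < g0 \<epsilon> n" if "0 \<le> \<epsilon>" "1 \<le> n" for \<epsilon> n
    using \<tau>[of \<epsilon>] that by (simp add: g0_def add_nonneg_pos)
  have g1: "0 < g1 n" for n using \<kappa> by (simp add: g1_def add_pos_nonneg)
  have cov: "cov_noisy \<sigma> (S \<epsilon>) n = g0 \<epsilon> n *\<^sub>R mat 1 + g1 n *\<^sub>R P" for \<epsilon> n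
    unfolding cov_noisy_def \<tau>_def[symmetric] by (simp add: g0_def g1_def S_def algebra_simps)
  define C where "C \<epsilon> n = (\<epsilon> / g0 \<epsilon> n) *\<^sub>R mat 1
      + ((\<kappa> + \<epsilon>) / (g0 \<epsilon> n + g1 n) - \<epsilon> / g0 \<epsilon> n) *\<^sub>R P" for \<epsilon> n
  have C: "C \<epsilon> n ** cov_noisy \<sigma> (S \<epsilon>) n = S \<epsilon>" if "0 \<le> \<epsilon>" "1 \<le> n" for \<epsilon> n
  proof -
    define x y where "x = \<epsilon> / g0 \<epsilon> n" and "y = (\<kappa> + \<epsilon>) / (g0 \<epsilon> n + g1 n)"
    have "x * g0 \<epsilon> n = \<epsilon>" "y * (g0 \<epsilon> n + g1 n) = \<kappa> + \<epsilon>"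
      using g0[OF that] g1[of n] by (simp_all add: x_def y_def)
    moreover have "x * g1 n + (y - x) * g0 \<epsilon> n + (y - x) * g1 n = y * (g0 \<epsilon> n + g1 n) - x * g0 \<epsilon> n"
      by (simp add: algebra_simps)
    ultimately show ?thesis
      unfolding cov C_def x_def[symmetric] y_def[symmetric] mult by (simp add: S_def)
  qed
  have pos: "0 < (D ** cov_noisy \<sigma> (S \<epsilon>) n) \<bullet> D" if "0 \<le> \<epsilon>" "1 \<le> n" "D \<noteq> 0" for \<epsilon> n and D :: "real ^ 'd ^ 'd"
  proof -
    \<comment> \<open>\<open>P\<close> is symmetric and idempotent, so its share of the form is a
      square; strict positivity comes from the \<open>g0\<close> term.\<close>
    have "(D ** P) \<bullet> D = (D ** P) \<bullet> (D ** P)"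
      by (metis PP inner_matrix_mult matrix_mul_assoc trP)
    then have "(D ** cov_noisy \<sigma> (S \<epsilon>) n) \<bullet> D = g0 \<epsilon> n * (D \<bullet> D) + g1 n * ((D ** P) \<bullet> (D ** P))"
      by (simp add: cov matrix_mult.add_right matrix_mult.scaleR_right inner_add_left)
    moreover have "0 < g0 \<epsilon> n * (D \<bullet> D)" using g0[OF that(1,2)] that(3) by simp
    moreover have "0 \<le> g1 n * ((D ** P) \<bullet> (D ** P))" using g1[of n] by simp
    ultimately show ?thesis by simp
  qed

  \<comment> \<open>Optimality is exploited at the training length \<open>n\<close>, whereas the
    risk is expanded at the test length \<open>m\<close>, where the even part vanishes too.\<close>
  have risk: "risk \<sigma> (mvnormal (task_cov V \<epsilon>)) m (Wstar \<epsilon> n)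
      = \<sigma>\<^sup>2 + lin_risk \<sigma> (T + \<epsilon> *\<^sub>R mat 1) m (C \<epsilon> n)"
    if eps: "0 < \<epsilon>" and "1 \<le> m" "1 \<le> n" for \<epsilon> m n
  proof -
    let ?g = "\<lambda>v. \<Sum>k=1..K. 1 / real K * mvnormal_density (task_cov (U k) \<epsilon>) v"
    have "task_law (task_mixture K U \<epsilon>) ((1 / real K) *\<^sub>R (\<Sum>k=1..K. task_cov (U k) \<epsilon>))"
      unfolding task_mixture_def
      using assms(1) UU eps by (intro task_law_mixture task_law_task_cov) auto
    also have "(1 / real K) *\<^sub>R (\<Sum>k=1..K. task_cov (U k) \<epsilon>) = S \<epsilon>"
      using assms(1)
      by (simp add: task_cov_def sum.distrib S_def P_def \<kappa>_def scaleR_add_right sum_constant_scaleR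
          del: sum_constant)
    finally interpret train: regression_data "task_mixture K U \<epsilon>" "S \<epsilon>" \<sigma> n
      using \<open>1 \<le> n\<close> assms(3)
      by (intro regression_data.intro regression_data_axioms.intro)
    interpret test: regression_data "mvnormal (task_cov V \<epsilon>)" "task_cov V \<epsilon>" \<sigma> m
      using \<open>1 \<le> m\<close> assms(3)
      by (intro regression_data.intro regression_data_axioms.intro task_law_task_cov VV eps)
    have gpos: "0 < ?g v" for v
      using assms(1) UU eps
      by (intro sum_pos mult_pos_pos mvnormal_density_pos task_law_task_cov) auto
    have gm: "?g \<in> borel_measurable borel" by measurable
    note imp = train.optimal_weights_imp[OF assms(6)[OF eps \<open>1 \<le> n\<close>] task_mixture_def gm gpos
        C[OF less_imp_le[OF eps] \<open>1 \<le> n\<close>] pos[OF less_imp_le[OF eps] \<open>1 \<le> n\<close>]]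
    show ?thesis
      by (simp add: test.risk_eq imp) (simp add: task_cov_def T_def)
  qed

  \<comment> \<open>Off the range of \<open>P\<close> the eigenvalue of
    \<open>C \<epsilon> n\<close> tends to 0, since \<open>g0 \<epsilon> n\<close> keeps a positive
    limit; on the range it tends to the shrinkage factor \<open>A n\<close>.\<close>
  define A where "A n = \<kappa> / (g0 0 n + g1 n)" for n
  define L1 where "L1 m n = \<sigma>\<^sup>2 + lin_risk \<sigma> T m (A n *\<^sub>R P)" for m n
  define L2 where "L2 m = \<sigma>\<^sup>2 + lin_risk \<sigma> T m P" for m
  have "((\<lambda>\<epsilon>. risk \<sigma> (mvnormal (task_cov V \<epsilon>)) m (Wstar \<epsilon> n)) \<longlongrightarrow> L1 m n) (at_right 0)"
    if "1 \<le> m" "1 \<le> n" for m n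
  proof -
    have \<epsilon>: "((\<lambda>\<epsilon> :: real. \<epsilon>) \<longlongrightarrow> 0) (at_right 0)" by (rule tendsto_ident_at)
    have "((\<lambda>\<epsilon>. g0 \<epsilon> n) \<longlongrightarrow> (1 + 1 / real n) * 0 + (0 * real CARD('d) + \<kappa> * trace P + \<sigma>\<^sup>2) / real n) (at_right 0)"
      unfolding g0_def \<tau>_eq using that by (intro tendsto_intros \<epsilon>) auto
    then have lim_g0: "((\<lambda>\<epsilon>. g0 \<epsilon> n) \<longlongrightarrow> g0 0 n) (at_right 0)"
      by (simp add: g0_def \<tau>_eq)
    have "((\<lambda>\<epsilon>. C \<epsilon> n) \<longlongrightarrow> (0 / g0 0 n) *\<^sub>R mat 1 + ((\<kappa> + 0) / (g0 0 n + g1 n) - 0 / g0 0 n) *\<^sub>R P) (at_right 0)"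
      unfolding C_def using g0[of 0 n] g1[of n] that by (intro tendsto_intros lim_g0 \<epsilon>) auto
    then have lim_C: "((\<lambda>\<epsilon>. C \<epsilon> n) \<longlongrightarrow> A n *\<^sub>R P) (at_right 0)" by (simp add: A_def)
    have "((\<lambda>\<epsilon>. T + \<epsilon> *\<^sub>R mat 1) \<longlongrightarrow> T + 0 *\<^sub>R mat 1) (at_right 0)"
      by (intro tendsto_intros \<epsilon>)
    then have "((\<lambda>\<epsilon>. \<sigma>\<^sup>2 + lin_risk \<sigma> (T + \<epsilon> *\<^sub>R mat 1) m (C \<epsilon> n)) \<longlongrightarrow> L1 m n) (at_right 0)"
      unfolding L1_def by (intro tendsto_intros tendsto_lin_risk lim_C) simp
    moreover have "\<forall>\<^sub>F \<epsilon> in at_right 0. \<sigma>\<^sup>2 + lin_risk \<sigma> (T + \<epsilon> *\<^sub>R mat 1) m (C \<epsilon> n)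
        = risk \<sigma> (mvnormal (task_cov V \<epsilon>)) m (Wstar \<epsilon> n)"
      using eventually_at_right_less[of 0] by eventually_elim (rule risk[OF _ that, symmetric])
    ultimately show ?thesis by (rule Lim_transform_eventually)
  qed
  moreover have "(\<lambda>n. L1 m n) \<longlonglongrightarrow> L2 m" for m
  proof -
    \<comment> \<open>The denominator is \<open>g0 0 n + g1 n\<close> written out for the limit
      rules; it tends to \<kappa>, so the shrinkage disappears.\<close>
    have "(\<lambda>n. \<kappa> / (((1 + 1 / real n) * 0 + \<tau> 0 / real n) + (1 + 1 / real n) * \<kappa>)) \<longlonglongrightarrow> \<kappa> / (((1 + 0) * 0 + 0) + (1 + 0) * \<kappa>)"
      using \<kappa> by (intro tendsto_intros lim_1_over_n lim_const_over_n) auto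
    then have "A \<longlonglongrightarrow> 1" using \<kappa> by (simp add: A_def[abs_def] g0_def g1_def)
    then have "(\<lambda>n. A n *\<^sub>R P) \<longlonglongrightarrow> 1 *\<^sub>R P" by (intro tendsto_intros)
    then show ?thesis
      unfolding L1_def L2_def by (intro tendsto_intros tendsto_lin_risk) simp_all
  qed
  moreover have "L2 \<longlonglongrightarrow> \<sigma>\<^sup>2"
  proof -
    \<comment> \<open>The part of the excess without 1/m cancels, because \<open>P ** T = T\<close>
      and \<open>P \<bullet> T = trace T\<close>.\<close>
    have "(\<lambda>m. \<sigma>\<^sup>2 + (trace T - 2 * (P \<bullet> T) + (P ** (T + (1 / real m) *\<^sub>R (T + (trace T + \<sigma>\<^sup>2) *\<^sub>R mat 1))) \<bullet> P))
       \<longlonglongrightarrow> \<sigma>\<^sup>2 + (trace T - 2 * (P \<bullet> T) + (P ** (T + 0 *\<^sub>R (T + (trace T + \<sigma>\<^sup>2) *\<^sub>R mat 1))) \<bullet> P)"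
      by (intro tendsto_intros matrix_mult.tendsto lim_1_over_n)
    moreover have "P \<bullet> T = trace T"
      by (metis TP inner_matrix_mult matrix_mul_lid trP trace_eq_inner)
    ultimately show ?thesis
      by (simp add: L2_def[abs_def] lin_risk_def cov_noisy_def PT inner_commute)
  qed
  ultimately show ?thesis unfolding V_def by blast
qed

end
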